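(* Let $k\ge 3$ be an integer, $\alpha=\frac{1}{24k(k+1)}$, and let $n\ge \frac{18k}{\alpha^2}$ be an integer. Then the maximal spectral radius among all $n$-vertex minimally $k$-connected graphs is attained uniquely (up to isomorphism) by the complete bipartite graph $K_{k,n-k}$; likewise, the maximal spectral radius among all $n$-vertex minimally $k$-edge-connected graphs is attained uniquely (up to isomorphism) by $K_{k,n-k}$.
   Context: All graphs are finite and simple. The spectral radius of a graph is the largest eigenvalue of its adjacency matrix. The connectivity (resp. edge-connectivity) of a graph is the minimum number of vertices (resp. edges) whose removal results in a disconnected graph or in the trivial (one-vertex) graph. A graph is $k$-connected (resp. $k$-edge-connected) if its connectivity (resp. edge-connectivity) is at least $k$. A graph is minimally $k$-connected (resp. minimally $k$-edge-connected) if it is $k$-connected (resp. $k$-edge-connected) but deleting any one edge always leaves a graph that is not $k$-connected (resp. not $k$-edge-connected). *)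

theory Defs
  imports
    "Graph_Theory.Graph_Theory"
    "Jordan_Normal_Form.Char_Poly"
begin

text \<open>
  Finite simple graphs are the graphs \<open>G\<close> satisfying \<^const>\<open>pair_graph\<close>: finite, loopless,
  symmetric digraphs without parallel arcs. An undirected edge is therefore a pair of opposite
  arcs, and it is identified with the set of its two ends.
\<close>

definition edges :: "'a pair_pre_digraph \<Rightarrow> 'a set set" where
  "edges G = (\<lambda>(u, v). {u, v}) ` parcs G"

definition del_edges :: "'a pair_pre_digraph \<Rightarrow> 'a set set \<Rightarrow> 'a pair_pre_digraph" where
  "del_edges G F = \<lparr>pverts = pverts G, parcs = {(u, v) \<in> parcs G. {u, v} \<notin> F}\<rparr>"

definition del_verts :: "'a pair_pre_digraph \<Rightarrow> 'a set \<Rightarrow> 'a pair_pre_digraph" where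
  "del_verts G S =
     \<lparr>pverts = pverts G - S, parcs = {(u, v) \<in> parcs G. u \<notin> S \<and> v \<notin> S}\<rparr>"


section \<open>Connectivity\<close>

text \<open>
  The library's \<^const>\<open>connected\<close> is false for the graph without vertices. This does not affect
  the minimum in \<open>vertex_connectivity\<close> for nonempty graphs: removing all vertices but one
  already leaves the trivial graph. Edge removal keeps the vertex set, so in
  \<open>edge_connectivity\<close> the result is trivial only if the graph itself is.
\<close>

definition disconnected_or_trivial :: "'a pair_pre_digraph \<Rightarrow> bool" where
  "disconnected_or_trivial G \<longleftrightarrow> \<not> connected (with_proj G) \<or> card (pverts G) = 1"

definition vertex_connectivity :: "'a pair_pre_digraph \<Rightarrow> nat" where
  "vertex_connectivity G =
     Min {card S |S. S \<subseteq> pverts G \<and> disconnected_or_trivial (del_verts G S)}"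

definition edge_connectivity :: "'a pair_pre_digraph \<Rightarrow> nat" where
  "edge_connectivity G =
     Min {card F |F. F \<subseteq> edges G \<and> disconnected_or_trivial (del_edges G F)}"

definition k_connected :: "nat \<Rightarrow> 'a pair_pre_digraph \<Rightarrow> bool" where
  "k_connected k G \<longleftrightarrow> k \<le> vertex_connectivity G"

definition k_edge_connected :: "nat \<Rightarrow> 'a pair_pre_digraph \<Rightarrow> bool" where
  "k_edge_connected k G \<longleftrightarrow> k \<le> edge_connectivity G"

definition minimally_k_connected :: "nat \<Rightarrow> 'a pair_pre_digraph \<Rightarrow> bool" where
  "minimally_k_connected k G \<longleftrightarrow>
     k_connected k G \<and> (\<forall>e\<in>edges G. \<not> k_connected k (del_edges G {e}))"

definition minimally_k_edge_connected :: "nat \<Rightarrow> 'a pair_pre_digraph \<Rightarrow> bool" where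
  "minimally_k_edge_connected k G \<longleftrightarrow>
     k_edge_connected k G \<and> (\<forall>e\<in>edges G. \<not> k_edge_connected k (del_edges G {e}))"


section \<open>Spectral radius\<close>

text \<open>
  The library's matrices are indexed by \<open>0, 1, \<dots>\<close>, so an adjacency matrix is formed with respect
  to an enumeration \<open>vs\<close> of the vertices. Its eigenvalues do not depend on \<open>vs\<close>, see
  \<open>eigenvalue_adjacency_mat_cong\<close>.
\<close>

definition adjacency_mat :: "'a pair_pre_digraph \<Rightarrow> 'a list \<Rightarrow> real mat" where
  "adjacency_mat G vs =
     mat (length vs) (length vs) (\<lambda>(i, j). if (vs ! i, vs ! j) \<in> parcs G then 1 else 0)"

definition graph_eigenvalue :: "'a pair_pre_digraph \<Rightarrow> real \<Rightarrow> bool" where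
  "graph_eigenvalue G x \<longleftrightarrow>
     (\<exists>vs. distinct vs \<and> set vs = pverts G \<and> eigenvalue (adjacency_mat G vs) x)"

definition graph_spectral_radius :: "'a pair_pre_digraph \<Rightarrow> real" where
  "graph_spectral_radius G = Max {x. graph_eigenvalue G x}"

lemma eigenvalue_adjacency_mat_iff:
  assumes "distinct vs"
  shows "eigenvalue (adjacency_mat G vs) x \<longleftrightarrow>
    (\<exists>f. (\<exists>v\<in>set vs. f v \<noteq> 0) \<and>
         (\<forall>u\<in>set vs. (\<Sum>v\<in>set vs. (if (u, v) \<in> parcs G then 1 else 0) * f v) = x * f u))"
    (is "?L \<longleftrightarrow> ?R")
proof -
  let ?n = "length vs"
  have sum_vs: "(\<Sum>v\<in>set vs. g v) = (\<Sum>j<?n. g (vs ! j))" for g :: "'a \<Rightarrow> real"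
    by (rule sum.reindex_bij_betw[symmetric]) (rule bij_betw_nth[OF assms refl refl])
  have row: "(adjacency_mat G vs *\<^sub>v w) $ i
      = (\<Sum>j<?n. (if (vs ! i, vs ! j) \<in> parcs G then 1 else 0) * w $ j)"
    if "i < ?n" "w \<in> carrier_vec ?n" for i w
    using that by (auto simp: adjacency_mat_def scalar_prod_def lessThan_atLeast0 intro!: sum.cong)
  show ?thesis
  proof
    assume ?L
    then obtain w where w: "w \<in> carrier_vec ?n" "w \<noteq> 0\<^sub>v ?n"
      and ev: "adjacency_mat G vs *\<^sub>v w = x \<cdot>\<^sub>v w"
      by (auto simp: eigenvalue_def eigenvector_def adjacency_mat_def)
    define f where "f v = w $ (THE j. j < ?n \<and> vs ! j = v)" for v
    have f: "f (vs ! j) = w $ j" if "j < ?n" for j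
    proof -
      have "(THE i. i < ?n \<and> vs ! i = vs ! j) = j"
        using that assms by (intro the_equality) (auto simp: nth_eq_iff_index_eq)
      then show ?thesis by (simp add: f_def)
    qed
    obtain i where "i < ?n" "w $ i \<noteq> 0"
      using w by (metis carrier_vecD dim_vec eq_vecI index_zero_vec)
    then have "\<exists>v\<in>set vs. f v \<noteq> 0" using f nth_mem by metis
    moreover have "(\<Sum>v\<in>set vs. (if (u, v) \<in> parcs G then 1 else 0) * f v) = x * f u"
      if "u \<in> set vs" for u
    proof -
      from that obtain i where i: "i < ?n" "u = vs ! i" by (auto simp: in_set_conv_nth)
      have "(adjacency_mat G vs *\<^sub>v w) $ i = x * w $ i" using ev i w by simp
      then show ?thesis using i row[OF i(1) w(1)] by (simp add: sum_vs f)
    qed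
    ultimately show ?R by blast
  next
    assume ?R
    then obtain f where nz: "\<exists>v\<in>set vs. f v \<noteq> 0"
      and ev: "\<And>u. u \<in> set vs \<Longrightarrow>
        (\<Sum>v\<in>set vs. (if (u, v) \<in> parcs G then 1 else 0) * f v) = x * f u"
      by blast
    define w where "w = vec ?n (\<lambda>j. f (vs ! j))"
    have w: "w \<in> carrier_vec ?n" by (simp add: w_def)
    have "w \<noteq> 0\<^sub>v ?n"
      using nz by (auto simp: w_def vec_eq_iff in_set_conv_nth)
    moreover have "adjacency_mat G vs *\<^sub>v w = x \<cdot>\<^sub>v w"
    proof (rule eq_vecI)
      fix i assume "i < dim_vec (x \<cdot>\<^sub>v w)"
      then have i: "i < ?n" by (simp add: w_def)
      show "(adjacency_mat G vs *\<^sub>v w) $ i = (x \<cdot>\<^sub>v w) $ i"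
        using row[OF i w] ev[of "vs ! i"] i by (simp add: sum_vs w_def)
    qed (simp add: w_def adjacency_mat_def)
    ultimately show ?L using w by (auto simp: eigenvalue_def eigenvector_def adjacency_mat_def)
  qed
qed

lemma eigenvalue_adjacency_mat_cong:
  assumes "distinct vs" "distinct ws" "set vs = set ws"
  shows "eigenvalue (adjacency_mat G vs) x \<longleftrightarrow> eigenvalue (adjacency_mat G ws) x"
  using assms by (simp add: eigenvalue_adjacency_mat_iff)


section \<open>The complete bipartite graph\<close>

definition complete_bipartite :: "nat \<Rightarrow> nat \<Rightarrow> nat pair_pre_digraph" where
  "complete_bipartite a b =
     \<lparr>pverts = {..<a + b}, parcs = {..<a} \<times> {a..<a + b} \<union> {a..<a + b} \<times> {..<a}\<rparr>"

lemma complete_bipartite_digraph_complete_bipartite: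
  "complete_bipartite_digraph a b (with_proj (complete_bipartite a b))"
  unfolding complete_bipartite_digraph_pair_def complete_bipartite_def
  by (intro conjI exI[of _ "{..<a}"] exI[of _ "{a..<a + b}"]) auto

end

theory Submission
  imports Defs "Jordan_Normal_Form.Spectral_Radius"
begin

text \<open>
  In a minimally \<open>k\<close>-(edge-)connected graph the ends of every edge become separated after deleting
  that edge and some \<open>k - 1\<close> other vertices (in the edge version, one end of each further edge of the
  cut). Only this property is used. It bounds the number of edges between two disjoint vertex sets
  \<open>W\<close>, \<open>M\<close> by \<open>k (|W| + |M|)\<close> and within any vertex set \<open>H\<close> by \<open>2 k |H|\<close>.

  Let \<open>\<lambda> \<ge> sqrt (k (n - k))\<close> be an eigenvalue and let \<open>x\<close> be the absolute value of an eigenvector,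
  scaled to maximum 1, so that \<open>\<lambda> x\<close> is at most the sum of \<open>x\<close> over the neighbours. Counting
  walks of length two by means of the edge bounds shows that exactly \<open>k\<close> vertices have
  \<open>x \<ge> 1 / 2\<close>, and that this set \<open>L\<close> has a large common neighbourhood \<open>C\<close>. Then \<open>L\<close> and
  \<open>C\<close> are independent, and each vertex of the rest \<open>R\<close> misses a vertex of \<open>L\<close> and has at most
  \<open>k\<close> neighbours in \<open>C\<close>. Counting walks of length two from a vertex with \<open>x = 1\<close>, a vertex of
  \<open>R\<close> costs more than its edges outside \<open>L\<close> can gain, because all weights outside \<open>L\<close> turn
  out to be tiny. Hence \<open>R\<close> is empty and the graph is \<open>K\<^bsub>k,n-k\<^esub>\<close>.
\<close>

section \<open>Edge bounds from separations\<close>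

text \<open>Both notions of minimality are reduced to this property, so the extremal argument runs
  only once: \<open>S\<close> together with the single edge from \<open>u\<close> to
  \<open>v\<close> separates the two ends.\<close>

locale separable_graph =
  fixes V :: "'a set" and E :: "'a rel" and k :: nat
  assumes finite_V: "finite V"
    and E_subset: "E \<subseteq> V \<times> V"
    and E_sym: "(u, v) \<in> E \<Longrightarrow> (v, u) \<in> E"
    and E_irrefl: "(v, v) \<notin> E"
    and separation: "(u, v) \<in> E \<Longrightarrow> \<exists>S A B. S \<union> A \<union> B = V \<and> A \<inter> B = {} \<and> A \<inter> S = {} \<and>
      B \<inter> S = {} \<and> card S < k \<and> u \<in> A \<and> v \<in> B \<and> E \<inter> (A \<times> B) \<subseteq> {(u, v)}"
begin

abbreviation nbh :: "'a \<Rightarrow> 'a set" where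
  "nbh v \<equiv> E `` {v}"

text \<open>Pairs are ordered: for disjoint sets each edge counts once, whereas
  \<open>arcs_between H H\<close> is twice the number of edges inside \<open>H\<close>.\<close>

definition arcs_between :: "'a set \<Rightarrow> 'a set \<Rightarrow> nat" where
  "arcs_between X Y = card (E \<inter> (X \<times> Y))"

lemma finite_E: "finite E"
  using E_subset finite_V by (meson finite_SigmaI finite_subset)

lemma nbh_subset: "nbh v \<subseteq> V"
  using E_subset by auto

lemma finite_nbh: "finite (nbh v)"
  using nbh_subset finite_V finite_subset by blast

lemma arcs_between_commute: "arcs_between X Y = arcs_between Y X"
proof -
  have "bij_betw prod.swap (E \<inter> (X \<times> Y)) (E \<inter> (Y \<times> X))"
    by (rule bij_betwI[where g = prod.swap]) (auto simp: E_sym)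
  then show ?thesis
    unfolding arcs_between_def by (rule bij_betw_same_card)
qed

lemma arcs_between_Un_le: "arcs_between (X \<union> X') Y \<le> arcs_between X Y + arcs_between X' Y"
proof -
  have "E \<inter> ((X \<union> X') \<times> Y) = (E \<inter> (X \<times> Y)) \<union> (E \<inter> (X' \<times> Y))" by auto
  then show ?thesis unfolding arcs_between_def by (simp add: card_Un_le)
qed

lemma arcs_between_Un:
  assumes "X \<inter> X' = {}"
  shows "arcs_between (X \<union> X') Y = arcs_between X Y + arcs_between X' Y"
proof -
  have "E \<inter> ((X \<union> X') \<times> Y) = (E \<inter> (X \<times> Y)) \<union> (E \<inter> (X' \<times> Y))" by auto
  then show ?thesis
    unfolding arcs_between_def using assms finite_E by (auto intro!: card_Un_disjoint)
qed

lemma arcs_between_Un_right: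
  assumes "Y \<inter> Y' = {}"
  shows "arcs_between X (Y \<union> Y') = arcs_between X Y + arcs_between X Y'"
  using arcs_between_Un[OF assms] by (simp add: arcs_between_commute[of X])

lemma arcs_between_mono: "X \<subseteq> X' \<Longrightarrow> Y \<subseteq> Y' \<Longrightarrow> arcs_between X Y \<le> arcs_between X' Y'"
  unfolding arcs_between_def using finite_E by (intro card_mono) auto

lemma arcs_between_singleton: "arcs_between {v} Y = card (nbh v \<inter> Y)"
proof -
  have "E \<inter> ({v} \<times> Y) = Pair v ` (nbh v \<inter> Y)" by auto
  then show ?thesis unfolding arcs_between_def by (simp add: card_image inj_on_def)
qed

lemma arcs_between_sum:
  assumes "finite X"
  shows "arcs_between X Y = (\<Sum>v\<in>X. card (nbh v \<inter> Y))"
  using assms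
proof induction
  case (insert x X)
  have "arcs_between (insert x X) Y = arcs_between {x} Y + arcs_between X Y"
    using insert arcs_between_Un[of "{x}" X Y] by simp
  then show ?case using insert by (simp add: arcs_between_singleton)
qed (simp add: arcs_between_def)

lemma arcs_between_le_card: "finite X \<Longrightarrow> finite Y \<Longrightarrow> arcs_between X Y \<le> card X * card Y"
  unfolding arcs_between_def card_cartesian_product[symmetric] by (intro card_mono) auto

text \<open>Of the more than k neighbours of \<open>w\<close> in \<open>M\<close>, all but
  \<open>m\<close> must lie in \<open>A \<union> S\<close>. As \<open>S\<close> has fewer than k
  elements, one of them is in \<open>A\<close>, and its own neighbours in \<open>W\<close> cannot
  cross to \<open>B\<close> either. This keeps both halves of a split large enough for the induction
  in Mader's bound.\<close>

lemma separation_side_card: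
  assumes disj: "W \<inter> M = {}" and W: "W \<subseteq> V" and M: "M \<subseteq> V" and wm: "w \<in> W" "m \<in> M"
    and degW: "\<And>v. v \<in> W \<Longrightarrow> k < card (nbh v \<inter> M)"
    and degM: "\<And>v. v \<in> M \<Longrightarrow> k < card (nbh v \<inter> W)"
    and cover: "V = S \<union> A \<union> B" and S: "card S < k" "finite S" and wA: "w \<in> A"
    and cross: "\<And>a b. a \<in> A \<Longrightarrow> b \<in> B \<Longrightarrow> (a, b) \<in> E \<Longrightarrow> a = w \<and> b = m"
  shows "k \<le> card (M \<inter> (A \<union> S)) \<and> k \<le> card (W \<inter> (A \<union> S))"
proof -
  have fin: "finite W" "finite M" using W M finite_V finite_subset by blast+
  let ?N = "nbh w \<inter> M - {m}"
  have N: "k \<le> card ?N" using degW[OF wm(1)] diff_card_le_card_Diff[of "{m}" "nbh w \<inter> M"] by simp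
  have sub: "?N \<subseteq> M \<inter> (A \<union> S)" using cross wA cover M by auto
  have 1: "k \<le> card (M \<inter> (A \<union> S))"
    using card_mono[OF _ sub] N fin by simp
  have "\<not> ?N \<subseteq> S" using card_mono[of S ?N] S N by auto
  then obtain m' where m': "m' \<in> ?N" "m' \<notin> S" by blast
  then have "m' \<in> A" using sub by auto
  then have "nbh m' \<inter> W \<subseteq> W \<inter> (A \<union> S)" using cross[of m'] m' wm disj cover W by auto
  from card_mono[OF _ this] have "k \<le> card (W \<inter> (A \<union> S))"
    using degM[of m'] m' fin by fastforce
  with 1 show ?thesis by simp
qed

text \<open>Mader's bipartite bound: a separation with sides \<open>A\<close>, \<open>B\<close> splits the bipartite graph into two
  that overlap in at most \<open>k - 1\<close> vertices, which the term \<open>k * k\<close> absorbs.\<close>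

lemma bipartite_arcs_le_aux:
  assumes "W \<inter> M = {}" "W \<subseteq> V" "M \<subseteq> V" "k \<le> card W" "k \<le> card M"
  shows "arcs_between W M + k * k \<le> k * (card W + card M)"
  using assms
proof (induction "card W + card M" arbitrary: W M rule: less_induct)
  case less
  have fin: "finite W" "finite M" using less.prems finite_V finite_subset by blast+
  \<comment> \<open>A side of size exactly k is settled by the product of the cardinalities, and a
    vertex of degree at most k can be deleted. Otherwise all bipartite degrees exceed k and a
    separation splits the graph.\<close>
  consider "card M = k" | "card W = k"
    | w where "k < card W" "w \<in> W" "card (nbh w \<inter> M) \<le> k"
    | m where "k < card M" "m \<in> M" "card (nbh m \<inter> W) \<le> k"
    | "k < card W" "k < card M" "\<And>v. v \<in> W \<Longrightarrow> k < card (nbh v \<inter> M)"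
      "\<And>v. v \<in> M \<Longrightarrow> k < card (nbh v \<inter> W)"
    using less.prems(4,5) by (meson le_neq_implies_less not_less)
  then show ?case
  proof cases
    case 1
    then show ?thesis using arcs_between_le_card[OF fin] by (simp add: algebra_simps)
  next
    case 2
    then show ?thesis using arcs_between_le_card[OF fin] by (simp add: algebra_simps)
  next
    case 3
    have c: "card (W - {w}) + 1 = card W" using 3 fin by (metis Suc_eq_plus1 card_Suc_Diff1)
    have ge: "k \<le> card (W - {w})" "card (W - {w}) < card W" using c 3(1) by linarith+
    have "arcs_between (W - {w}) M + k * k \<le> k * (card (W - {w}) + card M)"
      using less.prems ge by (intro less.hyps) (simp, blast+)
    moreover have "arcs_between W M = card (nbh w \<inter> M) + arcs_between (W - {w}) M"
      using arcs_between_Un[of "{w}" "W - {w}" M] 3(2) by (simp add: insert_absorb arcs_between_singleton)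
    ultimately show ?thesis using 3(3) unfolding c[symmetric] by (simp add: algebra_simps)
  next
    case 4
    have c: "card (M - {m}) + 1 = card M" using 4 fin by (metis Suc_eq_plus1 card_Suc_Diff1)
    have ge: "k \<le> card (M - {m})" "card (M - {m}) < card M" using c 4(1) by linarith+
    have "arcs_between W (M - {m}) + k * k \<le> k * (card W + card (M - {m}))"
      using less.prems ge by (intro less.hyps) (simp, blast+)
    moreover have "arcs_between M W = card (nbh m \<inter> W) + arcs_between (M - {m}) W"
      using arcs_between_Un[of "{m}" "M - {m}" W] 4(2) by (simp add: insert_absorb arcs_between_singleton)
    ultimately show ?thesis using 4(3) unfolding c[symmetric] arcs_between_commute[of W]
      by (simp add: algebra_simps)
  next
    case 5
    obtain w where w: "w \<in> W" using 5(1) by (metis all_not_in_conv card.empty not_less_zero)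
    obtain m where m: "m \<in> M" "(w, m) \<in> E"
      using 5(3)[OF w] by (metis Image_singleton_iff IntE all_not_in_conv card.empty not_less_zero)
    obtain S A B where sep: "S \<union> A \<union> B = V" "A \<inter> B = {}" "A \<inter> S = {}" "B \<inter> S = {}"
      "card S < k" "w \<in> A" "m \<in> B" "E \<inter> (A \<times> B) \<subseteq> {(w, m)}"
      using separation[OF m(2)] by blast
    have finS: "finite S" using sep(1) finite_V by (metis finite_Un)
    define W1 M1 W2 M2 where defs: "W1 = W \<inter> (A \<union> S)" "M1 = M \<inter> (A \<union> S)"
      "W2 = W \<inter> (B \<union> S)" "M2 = M \<inter> (B \<union> S)"
    have cross: "a = w \<and> b = m" if "a \<in> A" "b \<in> B" "(a, b) \<in> E" for a b
      using sep(8) that by blast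
    have cover: "V = S \<union> A \<union> B" "V = S \<union> B \<union> A" using sep(1) by auto
    have big: "k \<le> card M1" "k \<le> card W1"
      using separation_side_card[OF less.prems(1-3) w m(1) 5(3,4) cover(1) sep(5) finS sep(6)]
        cross unfolding defs by blast+
    have "M \<inter> W = {}" using less.prems(1) by auto
    then have big': "k \<le> card W2" "k \<le> card M2"
      using separation_side_card[OF _ less.prems(3,2) m(1) w 5(4,3) cover(2) sep(5) finS sep(7)]
        cross E_sym unfolding defs by blast+
    have cW: "card W1 + card W2 = card W + card (W \<inter> S)"
    proof -
      have "W1 \<union> W2 = W" "W1 \<inter> W2 = W \<inter> S" using sep(1-4) less.prems(2) unfolding defs by auto
      then show ?thesis using card_Un_Int[of W1 W2] fin unfolding defs by simp
    qed
    have cM: "card M1 + card M2 = card M + card (M \<inter> S)"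
    proof -
      have "M1 \<union> M2 = M" "M1 \<inter> M2 = M \<inter> S" using sep(1-4) less.prems(3) unfolding defs by auto
      then show ?thesis using card_Un_Int[of M1 M2] fin unfolding defs by simp
    qed
    have cS: "card (W \<inter> S) + card (M \<inter> S) < k"
    proof -
      have "card (W \<inter> S) + card (M \<inter> S) = card ((W \<inter> S) \<union> (M \<inter> S))"
        using less.prems(1) finS by (subst card_Un_disjoint) auto
      also have "\<dots> \<le> card S" using finS by (intro card_mono) auto
      finally show ?thesis using sep(5) by simp
    qed
    \<comment> \<open>\<open>m\<close> lies in \<open>B\<close> and \<open>w\<close> in
      \<open>A\<close>, so each half loses a vertex and the induction measure drops.\<close>
    have "M1 \<subset> M" "W2 \<subset> W" using m w sep unfolding defs by auto
    moreover have "W1 \<subseteq> W" "M2 \<subseteq> M" unfolding defs by auto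
    ultimately have lt: "card W1 + card M1 < card W + card M" "card W2 + card M2 < card W + card M"
      using fin by (simp_all add: add_le_less_mono add_less_le_mono card_mono psubset_card_mono)
    have I1: "arcs_between W1 M1 + k * k \<le> k * (card W1 + card M1)"
      using less.prems lt big unfolding defs by (intro less.hyps) auto
    have I2: "arcs_between W2 M2 + k * k \<le> k * (card W2 + card M2)"
      using less.prems lt big' unfolding defs by (intro less.hyps) auto
    have "E \<inter> (W \<times> M) \<subseteq> (E \<inter> (W1 \<times> M1) \<union> E \<inter> (W2 \<times> M2)) \<union> {(w, m)}"
    proof
      fix p assume p: "p \<in> E \<inter> (W \<times> M)"
      then obtain a b where ab: "p = (a, b)" "a \<in> W" "b \<in> M" "(a, b) \<in> E" by auto
      have V: "a \<in> V" "b \<in> V" using ab less.prems by auto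
      have "\<not> (a \<in> B \<and> b \<in> A)"
        using sep(8) E_sym[OF ab(4)] ab(2,3) w m less.prems(1) by auto
      moreover have "a \<in> A \<and> b \<in> B \<Longrightarrow> a = w \<and> b = m" using sep(8) ab(4) by auto
      ultimately show "p \<in> (E \<inter> (W1 \<times> M1) \<union> E \<inter> (W2 \<times> M2)) \<union> {(w, m)}"
        using ab V sep(1) unfolding defs by auto
    qed
    then have "arcs_between W M \<le> card ((E \<inter> (W1 \<times> M1) \<union> E \<inter> (W2 \<times> M2)) \<union> {(w, m)})"
      unfolding arcs_between_def using finite_E by (intro card_mono) auto
    also have "\<dots> \<le> card (E \<inter> (W1 \<times> M1)) + card (E \<inter> (W2 \<times> M2)) + 1"
      by (metis (no_types, lifting) add_le_mono card_Un_le is_singletonI is_singleton_altdef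
          le_trans order_refl)
    finally have I3: "arcs_between W M \<le> arcs_between W1 M1 + arcs_between W2 M2 + 1"
      unfolding arcs_between_def .
    \<comment> \<open>The induction hypotheses supply \<open>k * k\<close> twice. One copy is kept
      for the claim; the other covers the overlap, which costs at most \<open>k * (k - 1)\<close>,
      and leaves k to pay for the arc \<open>(w, m)\<close> that neither half contains.\<close>
    have "card W1 + card M1 + (card W2 + card M2) + 1 \<le> card W + card M + k"
      using cW cM cS by simp
    then have "k * (card W1 + card M1 + (card W2 + card M2) + 1) \<le> k * (card W + card M + k)"
      by (rule mult_le_mono2)
    then have "k * (card W1 + card M1) + k * (card W2 + card M2) + k \<le> k * (card W + card M) + k * k"
      by (simp add: algebra_simps)
    then show ?thesis using I1 I2 I3 sep(5) by linarith
  qed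
qed

text \<open>Dropping \<open>k * k\<close> makes room for small sides: if one side has at most k
  vertices, the product of the cardinalities is already within the bound.\<close>

lemma bipartite_arcs_le:
  assumes "W \<inter> M = {}" "W \<subseteq> V" "M \<subseteq> V"
  shows "arcs_between W M \<le> k * (card W + card M)"
proof -
  have fin: "finite W" "finite M" using assms finite_V finite_subset by blast+
  consider "k \<le> card W \<and> k \<le> card M" | "card W \<le> k" | "card M \<le> k" by linarith
  then show ?thesis
  proof cases
    case 1
    then show ?thesis using bipartite_arcs_le_aux[OF assms] by simp
  next
    case 2
    then have "card W * card M \<le> k * (card W + card M)" by (intro mult_le_mono) auto
    then show ?thesis using arcs_between_le_card[OF fin] by simp
  next
    case 3
    then have "card W * card M \<le> (card W + card M) * k" by (intro mult_le_mono) auto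
    then show ?thesis using arcs_between_le_card[OF fin] by (simp add: mult.commute)
  qed
qed

text \<open>Greedy cut: a new vertex joins the side that holds fewer of its neighbours, so at least
  half of its edges cross. The factor 4 combines this half with the double count in
  \<open>arcs_between H H\<close>.\<close>

lemma ex_large_cut:
  assumes "finite H"
  shows "\<exists>X Y. X \<inter> Y = {} \<and> X \<union> Y = H \<and> arcs_between H H \<le> 4 * arcs_between X Y"
  using assms
proof induction
  case empty
  then show ?case by (auto simp: arcs_between_def)
next
  case (insert v H)
  then obtain X Y where XY: "X \<inter> Y = {}" "X \<union> Y = H" "arcs_between H H \<le> 4 * arcs_between X Y"
    by blast
  have fin: "finite X" "finite Y" using insert(1) XY(2) by auto
  have v: "v \<notin> X" "v \<notin> Y" using insert(2) XY(2) by auto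
  have H: "card (nbh v \<inter> H) = card (nbh v \<inter> X) + card (nbh v \<inter> Y)"
    using XY fin by (subst card_Un_disjoint[symmetric]) (auto intro!: arg_cong[of _ _ card])
  have vv: "arcs_between {v} {v} = 0" using E_irrefl by (auto simp: arcs_between_def)
  have "arcs_between (insert v H) (insert v H)
      = arcs_between {v} ({v} \<union> H) + arcs_between H ({v} \<union> H)"
    using arcs_between_Un[of "{v}" H "{v} \<union> H"] insert(2) by simp
  also have "\<dots> = arcs_between {v} H + (arcs_between H {v} + arcs_between H H)"
    using insert(2) by (simp add: arcs_between_Un_right vv del: Un_insert_left)
  finally have arcs: "arcs_between (insert v H) (insert v H) = arcs_between H H + 2 * card (nbh v \<inter> H)"
    by (simp add: arcs_between_commute[of H "{v}"] arcs_between_singleton)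
  show ?case
  proof (cases "card (nbh v \<inter> X) \<le> card (nbh v \<inter> Y)")
    case True
    have "arcs_between (insert v X) Y = card (nbh v \<inter> Y) + arcs_between X Y"
      using arcs_between_Un[of "{v}" X Y] v by (simp add: arcs_between_singleton)
    then show ?thesis using XY v arcs H True
      by (intro exI[of _ "insert v X"] exI[of _ Y]) auto
  next
    case False
    have "arcs_between X (insert v Y) = card (nbh v \<inter> X) + arcs_between X Y"
      using arcs_between_Un_right[of "{v}" Y X] v
      by (simp add: arcs_between_singleton arcs_between_commute[of X "{v}"])
    then show ?thesis using XY v arcs H False
      by (intro exI[of _ X] exI[of _ "insert v Y"]) auto
  qed
qed

lemma arcs_within_le:
  assumes "H \<subseteq> V"
  shows "arcs_between H H \<le> 4 * k * card H"
proof -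
  have fin: "finite H" using assms finite_V finite_subset by blast
  obtain X Y where XY: "X \<inter> Y = {}" "X \<union> Y = H" "arcs_between H H \<le> 4 * arcs_between X Y"
    using ex_large_cut[OF fin] by blast
  have "card H = card X + card Y" using XY fin by (metis card_Un_disjoint finite_Un)
  moreover have "X \<subseteq> V" "Y \<subseteq> V" using XY(2) assms by auto
  then have "arcs_between X Y \<le> k * (card X + card Y)" using bipartite_arcs_le XY(1) by blast
  ultimately show ?thesis using XY(3) by simp
qed

text \<open>Weighted form of \<open>arcs_within_le\<close>, by peeling off levels: subtracting the
  minimum weight everywhere takes that constant off each arc, which \<open>arcs_within_le\<close>
  pays for, and leaves a vertex of weight 0 whose arcs no longer contribute.\<close>

lemma sum_min_arcs_le:
  fixes y :: "'a \<Rightarrow> real"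
  assumes "finite H" "H \<subseteq> V" "\<And>v. v \<in> H \<Longrightarrow> 0 \<le> y v"
  shows "(\<Sum>(v, w)\<in>E \<inter> (H \<times> H). min (y v) (y w)) \<le> 4 * k * (\<Sum>v\<in>H. y v)"
  using assms
proof (induction "card H" arbitrary: H y rule: less_induct)
  case less
  show ?case
  proof (cases "H = {}")
    case False
    define m where "m = Min (y ` H)"
    obtain v0 where v0: "v0 \<in> H" "y v0 = m"
      using Min_in[of "y ` H"] False less.prems(1) unfolding m_def by fastforce
    have m: "m \<le> y v" if "v \<in> H" for v using that less.prems(1) unfolding m_def by simp
    have m0: "0 \<le> m" using v0 less.prems(3) by metis
    define z where "z v = y v - m" for v
    define H' where "H' = H - {v0}"
    have z0: "z v0 = 0" using v0 by (simp add: z_def)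
    have zpos: "0 \<le> z v" if "v \<in> H" for v using m[OF that] by (simp add: z_def)
    have fin: "finite (E \<inter> (H \<times> H))" using finite_E by simp
    have "card H' < card H" using v0 less.prems(1) unfolding H'_def by (metis card_Diff1_less)
    then have IH: "(\<Sum>(v, w)\<in>E \<inter> (H' \<times> H'). min (z v) (z w)) \<le> 4 * k * (\<Sum>v\<in>H'. z v)"
      using less.prems zpos unfolding H'_def by (intro less.hyps) auto
    have "(\<Sum>(v, w)\<in>E \<inter> (H \<times> H). min (y v) (y w))
        = (\<Sum>p\<in>E \<inter> (H \<times> H). m + (case p of (v, w) \<Rightarrow> min (z v) (z w)))"
      by (intro sum.cong) (auto simp: z_def)
    also have "\<dots> = m * arcs_between H H + (\<Sum>(v, w)\<in>E \<inter> (H \<times> H). min (z v) (z w))"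
      by (simp add: sum.distrib arcs_between_def mult.commute)
    also have "(\<Sum>(v, w)\<in>E \<inter> (H \<times> H). min (z v) (z w)) = (\<Sum>(v, w)\<in>E \<inter> (H' \<times> H'). min (z v) (z w))"
    proof (rule sum.mono_neutral_right[OF fin])
      show "\<forall>p\<in>E \<inter> (H \<times> H) - E \<inter> (H' \<times> H'). (case p of (v, w) \<Rightarrow> min (z v) (z w)) = 0"
        using zpos unfolding H'_def by (auto simp: z0 min_absorb1 min_absorb2)
    qed (auto simp: H'_def)
    also have "m * arcs_between H H + \<dots> \<le> m * (4 * k * card H) + 4 * k * (\<Sum>v\<in>H'. z v)"
      using IH mult_left_mono[OF of_nat_mono[OF arcs_within_le[OF less.prems(2)]] m0] by simp
    also have "(\<Sum>v\<in>H'. z v) = (\<Sum>v\<in>H. z v)"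
      using v0 z0 less.prems(1) unfolding H'_def by (simp add: sum.remove[of H v0])
    also have "\<dots> = (\<Sum>v\<in>H. y v) - m * card H" by (simp add: z_def sum_subtractf)
    finally show ?thesis by (simp add: algebra_simps)
  qed simp
qed

end

section \<open>Large eigenvalues\<close>

text \<open>\<open>x\<close> stands for the absolute values of an eigenvector divided by their
  maximum, which is attained at \<open>us\<close>; the triangle inequality turns the eigenvalue
  equation into \<open>lam_x_le\<close>. The bound on \<open>card V\<close> is
  \<open>18 * k / \<alpha>\<^sup>2\<close> multiplied out.\<close>

locale dominated_vector = separable_graph +
  fixes x :: "'a \<Rightarrow> real" and lam :: real and us :: 'a
  assumes k_ge_3: "3 \<le> k"
    and card_V_ge: "10368 * real k ^ 3 * (real k + 1)\<^sup>2 \<le> real (card V)"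
    and lam_pos: "0 < lam"
    and lam_sq_ge: "real k * (real (card V) - real k) \<le> lam\<^sup>2"
    and x_nonneg: "v \<in> V \<Longrightarrow> 0 \<le> x v"
    and x_le_1: "v \<in> V \<Longrightarrow> x v \<le> 1"
    and us: "us \<in> V" "x us = 1"
    and lam_x_le: "v \<in> V \<Longrightarrow> lam * x v \<le> (\<Sum>w\<in>nbh v. x w)"
begin

text \<open>For \<open>X = nbh u\<close> and \<open>Y = V\<close> this is the entry at
  \<open>u\<close> of the squared adjacency matrix applied to \<open>x\<close>: walks of length two
  from \<open>u\<close>, weighted by their ends. Splitting \<open>Y\<close> sorts the walks by their
  last vertex.\<close>

definition wt :: "'a set \<Rightarrow> 'a set \<Rightarrow> real" where
  "wt X Y = (\<Sum>w\<in>X. \<Sum>z\<in>nbh w \<inter> Y. x z)"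

lemma wt_Un:
  assumes "X \<inter> X' = {}" "X \<subseteq> V" "X' \<subseteq> V"
  shows "wt (X \<union> X') Y = wt X Y + wt X' Y"
  unfolding wt_def using assms finite_V finite_subset by (intro sum.union_disjoint) auto

lemma wt_Un_right:
  assumes "Y \<inter> Y' = {}"
  shows "wt X (Y \<union> Y') = wt X Y + wt X Y'"
proof -
  have "(\<Sum>z\<in>nbh w \<inter> (Y \<union> Y'). x z) = (\<Sum>z\<in>nbh w \<inter> Y. x z) + (\<Sum>z\<in>nbh w \<inter> Y'. x z)" for w
    unfolding Int_Un_distrib using assms finite_nbh by (intro sum.union_disjoint) auto
  then show ?thesis unfolding wt_def by (simp add: sum.distrib)
qed

lemma wt_mono:
  assumes "X \<subseteq> X'" "X' \<subseteq> V" "Y \<subseteq> V"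
  shows "wt X Y \<le> wt X' Y"
  unfolding wt_def using assms finite_V finite_subset x_nonneg
  by (intro sum_mono2 sum_nonneg) blast+

lemma wt_le:
  assumes "X \<subseteq> V" "\<And>z. z \<in> Y \<Longrightarrow> x z \<le> c"
  shows "wt X Y \<le> c * arcs_between X Y"
proof -
  have fin: "finite X" using assms(1) finite_V finite_subset by blast
  have "wt X Y \<le> (\<Sum>w\<in>X. real (card (nbh w \<inter> Y)) * c)"
    unfolding wt_def using assms by (intro sum_mono sum_bounded_above) auto
  also have "\<dots> = c * arcs_between X Y"
    by (simp add: arcs_between_sum[OF fin] sum_distrib_left mult.commute)
  finally show ?thesis .
qed

lemma wt_arcs:
  assumes "X \<subseteq> V"
  shows "wt X Y = (\<Sum>(w, z)\<in>E \<inter> (X \<times> Y). x z)"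
proof -
  have "(\<Sum>(w, z)\<in>E \<inter> (X \<times> Y). x z) = (\<Sum>(w, z)\<in>Sigma X (\<lambda>w. nbh w \<inter> Y). x z)"
    by (intro sum.cong) auto
  also have "\<dots> = wt X Y"
    unfolding wt_def using assms finite_V finite_subset finite_nbh
    by (intro sum.Sigma[symmetric]) auto
  finally show ?thesis by simp
qed

lemma wt_V:
  assumes "Y \<subseteq> V"
  shows "wt V Y = (\<Sum>z\<in>Y. card (nbh z) * x z)"
proof -
  have fin: "finite Y" using assms finite_V finite_subset by blast
  have "wt V Y = (\<Sum>(w, z)\<in>E \<inter> (V \<times> Y). x z)" by (simp add: wt_arcs)
  also have "\<dots> = (\<Sum>(z, w)\<in>Sigma Y nbh. x z)"
    using E_subset
    by (intro sum.reindex_bij_witness[where i = prod.swap and j = prod.swap]) (auto simp: E_sym)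
  also have "\<dots> = (\<Sum>z\<in>Y. \<Sum>w\<in>nbh z. x z)"
    using fin finite_nbh by (intro sum.Sigma[symmetric]) auto
  finally show ?thesis by simp
qed

lemma lam_sum_le:
  assumes "W \<subseteq> V"
  shows "lam * (\<Sum>w\<in>W. x w) \<le> wt W V"
proof -
  have "nbh w \<inter> V = nbh w" for w using nbh_subset by blast
  then show ?thesis
    unfolding wt_def sum_distrib_left using assms lam_x_le by (intro sum_mono) auto
qed

lemma lam_sq_x_le:
  assumes "u \<in> V"
  shows "lam\<^sup>2 * x u \<le> wt (nbh u) V"
proof -
  have "lam * (lam * x u) \<le> lam * (\<Sum>w\<in>nbh u. x w)"
    using lam_x_le[OF assms] lam_pos by simp
  then show ?thesis using lam_sum_le[OF nbh_subset, of u] by (simp add: power2_eq_square algebra_simps)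
qed

definition S :: real where "S = (\<Sum>v\<in>V. x v)"

lemma lam_S_le: "lam * S \<le> 4 * k * card V"
proof -
  have "lam * S \<le> wt V V" unfolding S_def by (rule lam_sum_le) simp
  also have "\<dots> \<le> 1 * real (arcs_between V V)" using x_le_1 by (intro wt_le) auto
  also have "\<dots> \<le> 4 * k * card V" using arcs_within_le[of V] by (simp flip: of_nat_mult)
  finally show ?thesis by simp
qed

text \<open>The test weight \<open>y\<close> is 1 on the neighbourhood of \<open>u\<close>, so an
  arc \<open>(v, w)\<close> leaving it has \<open>min (y v) (y w) = y w\<close>, which is at least
  \<open>x w\<close>. The weighted arc bound then charges the walks to the total of
  \<open>y\<close>.\<close>

lemma lam_sq_x_le_degree:
  assumes "u \<in> V"
  shows "lam\<^sup>2 * x u \<le> 4 * k * (card (nbh u) + S)"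
proof -
  define y where "y v = (if v \<in> nbh u then 1 else x v)" for v
  have y0: "0 \<le> y v" if "v \<in> V" for v using x_nonneg that by (simp add: y_def)
  have "wt (nbh u) V \<le> (\<Sum>(v, w)\<in>E \<inter> (nbh u \<times> V). min (y v) (y w))"
    unfolding wt_arcs[OF nbh_subset] using x_le_1 by (intro sum_mono) (auto simp: y_def)
  also have "\<dots> \<le> (\<Sum>(v, w)\<in>E \<inter> (V \<times> V). min (y v) (y w))"
    using finite_E y0 nbh_subset by (intro sum_mono2) auto
  also have "\<dots> \<le> 4 * k * (\<Sum>v\<in>V. y v)"
    using y0 finite_V by (intro sum_min_arcs_le) auto
  also have "(\<Sum>v\<in>V. y v) \<le> (\<Sum>v\<in>V. (if v \<in> nbh u then 1 else 0) + x v)"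
    using x_nonneg by (intro sum_mono) (auto simp: y_def)
  also have "\<dots> = card (nbh u) + S"
  proof -
    have "V \<inter> nbh u = nbh u" using nbh_subset by blast
    then show ?thesis
      using finite_V sum.inter_restrict[of V "\<lambda>_. 1 :: real" "nbh u"]
      by (simp add: sum.distrib S_def)
  qed
  finally show ?thesis using lam_sq_x_le[OF assms] by (simp add: mult_left_mono)
qed

text \<open>The threshold makes the arcs that end outside \<open>M\<close>, at most
  \<open>4 * k * n\<close> in number, carry total weight at most \<open>n / 5\<close>. It is still
  high enough to force degrees of order \<open>n / k\<close> on \<open>M\<close>, hence a size of
  order \<open>k\<^sup>2\<close>.\<close>

definition M :: "'a set" where "M = {z \<in> V. 1 / (20 * real k) \<le> x z}"

abbreviation n :: real where "n \<equiv> real (card V)"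
abbreviation \<kappa> :: real where "\<kappa> \<equiv> real k"
abbreviation m :: real where "m \<equiv> real (card M)"

lemma \<kappa>_ge_3: "3 \<le> \<kappa>"
  using k_ge_3 by simp

lemma n_ge: "165888 * \<kappa> ^ 3 \<le> n"
proof -
  have "4\<^sup>2 \<le> (\<kappa> + 1)\<^sup>2" using \<kappa>_ge_3 by (intro power_mono) auto
  then have "10368 * \<kappa> ^ 3 * 4\<^sup>2 \<le> 10368 * \<kappa> ^ 3 * (\<kappa> + 1)\<^sup>2"
    by (intro mult_left_mono) auto
  then show ?thesis using card_V_ge by simp
qed

lemma \<kappa>_sq_le: "9 \<le> \<kappa>\<^sup>2" "3 * \<kappa> \<le> \<kappa>\<^sup>2" "3 * \<kappa>\<^sup>2 \<le> \<kappa> ^ 3" "\<kappa> \<le> \<kappa>\<^sup>2"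
proof -
  show "9 \<le> \<kappa>\<^sup>2" using power_mono[OF \<kappa>_ge_3, of 2] by simp
  show "3 * \<kappa> \<le> \<kappa>\<^sup>2" using \<kappa>_ge_3 by (simp add: power2_eq_square)
  then show "\<kappa> \<le> \<kappa>\<^sup>2" using \<kappa>_ge_3 by linarith
  show "3 * \<kappa>\<^sup>2 \<le> \<kappa> ^ 3" using \<kappa>_ge_3 by (simp add: power2_eq_square power3_eq_cube mult_right_mono)
qed

lemma lam_ge: "101 * \<kappa>\<^sup>2 * (\<kappa> + 1) \<le> lam"
proof (rule power2_le_imp_le)
  have "1 \<le> \<kappa>\<^sup>2" "1 \<le> (\<kappa> + 1)\<^sup>2" using \<kappa>_ge_3 by simp_all
  then have "1 * 1 \<le> \<kappa>\<^sup>2 * (\<kappa> + 1)\<^sup>2" by (intro mult_mono) auto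
  then have "\<kappa> * 1 \<le> \<kappa> * (\<kappa>\<^sup>2 * (\<kappa> + 1)\<^sup>2)" by (intro mult_left_mono) auto
  then have "\<kappa> \<le> \<kappa> ^ 3 * (\<kappa> + 1)\<^sup>2" by (simp add: power3_eq_cube power2_eq_square algebra_simps)
  \<comment> \<open>Here \<open>10201 = 101\<^sup>2\<close>; the gap to 10368 absorbs the subtracted
    \<open>\<kappa>\<close>.\<close>
  then have "10201 * \<kappa> ^ 3 * (\<kappa> + 1)\<^sup>2 \<le> n - \<kappa>" using card_V_ge by linarith
  then have "\<kappa> * (10201 * \<kappa> ^ 3 * (\<kappa> + 1)\<^sup>2) \<le> \<kappa> * (n - \<kappa>)" by (intro mult_left_mono) auto
  moreover have "(101 * \<kappa>\<^sup>2 * (\<kappa> + 1))\<^sup>2 = \<kappa> * (10201 * \<kappa> ^ 3 * (\<kappa> + 1)\<^sup>2)"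
    by (simp add: power_mult_distrib power3_eq_cube power2_eq_square)
  ultimately show "(101 * \<kappa>\<^sup>2 * (\<kappa> + 1))\<^sup>2 \<le> lam\<^sup>2" using lam_sq_ge by linarith
qed (use lam_pos in simp)

lemma lam_ge': "404 * \<kappa>\<^sup>2 \<le> lam"
proof -
  have "101 * \<kappa>\<^sup>2 * 4 \<le> 101 * \<kappa>\<^sup>2 * (\<kappa> + 1)" using \<kappa>_ge_3 by (intro mult_left_mono) auto
  then show ?thesis using lam_ge by linarith
qed

lemma S_nonneg: "0 \<le> S"
  unfolding S_def using x_nonneg by (simp add: sum_nonneg)

lemma S_le: "101 * \<kappa> * S \<le> n"
proof -
  have "404 * \<kappa>\<^sup>2 * S \<le> lam * S" using lam_ge' S_nonneg by (rule mult_right_mono)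
  also note lam_S_le
  finally have "4 * \<kappa> * (101 * \<kappa> * S) \<le> 4 * \<kappa> * n" by (simp add: power2_eq_square)
  then show ?thesis using \<kappa>_ge_3 by simp
qed

lemma M_subset: "M \<subseteq> V" by (auto simp: M_def)

lemma finite_M: "finite M" using M_subset finite_V finite_subset by blast

text \<open>At this weight the walk count is still about \<open>n / 20\<close>, but at most
  \<open>4 * k\<close> times degree plus \<open>S\<close>. By \<open>S_le\<close> the share of
  \<open>S\<close> covers only 80/101 of that, so the degree has to supply the rest.\<close>

lemma degree_M:
  assumes "z \<in> M"
  shows "n \<le> 400 * \<kappa> * card (nbh z)"
proof -
  have z: "z \<in> V" "1 / (20 * \<kappa>) \<le> x z" using assms by (auto simp: M_def)
  have "0 \<le> lam\<^sup>2" by simp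
  have "(n - \<kappa>) / 20 = \<kappa> * (n - \<kappa>) * (1 / (20 * \<kappa>))" using \<kappa>_ge_3 by simp
  also have "\<dots> \<le> lam\<^sup>2 * x z"
    using lam_sq_ge z(2) by (intro mult_mono) auto
  also have "\<dots> \<le> 4 * \<kappa> * (card (nbh z) + S)" using lam_sq_x_le_degree[OF z(1)] by simp
  finally have "n - \<kappa> \<le> 80 * \<kappa> * (card (nbh z) + S)" by simp
  then have "101 * (n - \<kappa>) \<le> 8080 * \<kappa> * card (nbh z) + 80 * (101 * \<kappa> * S)"
    by (simp add: algebra_simps)
  then have "21 * n - 101 * \<kappa> \<le> 8080 * (\<kappa> * card (nbh z))" using S_le by simp
  moreover have "505 * \<kappa> \<le> n" using n_ge \<kappa>_sq_le by linarith
  ultimately show ?thesis by simp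
qed

lemma degree_sum_le: "Y \<subseteq> V \<Longrightarrow> (\<Sum>z\<in>Y. card (nbh z)) \<le> 4 * k * card Y + k * card V"
proof -
  assume Y: "Y \<subseteq> V"
  have fin: "finite Y" using Y finite_V finite_subset by blast
  have V: "V = Y \<union> (V - Y)" using Y by blast
  have "(\<Sum>z\<in>Y. card (nbh z)) = (\<Sum>z\<in>Y. card (nbh z \<inter> V))"
    using nbh_subset by (intro sum.cong refl arg_cong[of _ _ card]) blast
  also have "\<dots> = arcs_between Y (Y \<union> (V - Y))"
    using arcs_between_sum[OF fin, of V] V by simp
  also have "\<dots> = arcs_between Y Y + arcs_between Y (V - Y)" by (rule arcs_between_Un_right) auto
  also have "\<dots> \<le> 4 * k * card Y + k * (card Y + card (V - Y))"
    using Y by (intro add_mono arcs_within_le bipartite_arcs_le) auto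
  also have "card Y + card (V - Y) = card V"
    using Y fin finite_V by (simp add: card_Diff_subset card_mono)
  finally show ?thesis .
qed

text \<open>Degrees of at least \<open>n / (400 * k)\<close> on \<open>M\<close> are compared with
  the degree sum, at most \<open>4 * k * m + k * n\<close>. The leading terms give
  \<open>400 * k\<^sup>2\<close>; the extra 5 absorbs \<open>4 * k * m\<close>.\<close>

lemma m_le: "m \<le> 405 * \<kappa>\<^sup>2"
proof (rule ccontr)
  assume neg: "\<not> ?thesis"
  have "m * n = (\<Sum>z\<in>M. n)" by simp
  also have "\<dots> \<le> (\<Sum>z\<in>M. 400 * \<kappa> * card (nbh z))" using degree_M by (intro sum_mono)
  also have "\<dots> = 400 * \<kappa> * (\<Sum>z\<in>M. card (nbh z))" by (simp add: sum_distrib_left)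
  also have "\<dots> \<le> 400 * \<kappa> * (4 * \<kappa> * m + \<kappa> * n)"
    using of_nat_mono[OF degree_sum_le[OF M_subset], where 'a = real] by (intro mult_left_mono) auto
  finally have "m * (n - 1600 * \<kappa>\<^sup>2) \<le> 400 * \<kappa>\<^sup>2 * n" by (simp add: algebra_simps power2_eq_square)
  moreover have n: "129600 * \<kappa>\<^sup>2 < n" using n_ge \<kappa>_sq_le by linarith
  then have "405 * \<kappa>\<^sup>2 * (n - 1600 * \<kappa>\<^sup>2) \<le> m * (n - 1600 * \<kappa>\<^sup>2)"
    using neg by (intro mult_right_mono) auto
  ultimately have "\<kappa>\<^sup>2 * (5 * n) \<le> \<kappa>\<^sup>2 * (648000 * \<kappa>\<^sup>2)" by (simp add: algebra_simps)
  then have "5 * n \<le> 648000 * \<kappa>\<^sup>2" using \<kappa>_ge_3 by simp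
  then show False using n by simp
qed

lemma \<kappa>_m_le: "400 * (\<kappa> * m) \<le> n"
proof -
  have "\<kappa> * m \<le> \<kappa> * (405 * \<kappa>\<^sup>2)" using m_le by (intro mult_left_mono) auto
  also have "\<dots> = 405 * \<kappa> ^ 3" by (simp add: power2_eq_square power3_eq_cube)
  finally show ?thesis using n_ge \<kappa>_sq_le by linarith
qed

lemma wt_V_small: "wt V (V - M) \<le> n / 5"
proof -
  have "wt V (V - M) \<le> 1 / (20 * \<kappa>) * arcs_between V (V - M)"
    by (intro wt_le) (auto simp: M_def)
  also have "\<dots> \<le> 1 / (20 * \<kappa>) * (4 * \<kappa> * n)"
    using of_nat_mono[OF order_trans[OF arcs_between_mono[of V V "V - M" V] arcs_within_le[of V]],
        where 'a = real]
    by (intro mult_left_mono) auto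
  also have "\<dots> = n / 5" using \<kappa>_ge_3 by (simp add: field_simps)
  finally show ?thesis .
qed

lemma lam_sq_x_le_M:
  assumes "u \<in> V"
  shows "lam\<^sup>2 * x u \<le> wt (nbh u) M + n / 5"
proof -
  have V: "V = M \<union> (V - M)" using M_subset by auto
  have "wt (nbh u) V = wt (nbh u) M + wt (nbh u) (V - M)"
    using wt_Un_right[of M "V - M" "nbh u"] V by simp
  moreover have "wt (nbh u) (V - M) \<le> wt V (V - M)" using nbh_subset by (intro wt_mono) auto
  ultimately show ?thesis using lam_sq_x_le[OF assms] wt_V_small by linarith
qed

text \<open>The degree now carries the factor k instead of the \<open>4 * k\<close> of
  \<open>lam_sq_x_le_degree\<close>: walks ending in \<open>M\<close> mostly enter it from outside,
  where the bipartite bound applies. The constant is 17/80 = 1/5 + 5/400, from the arcs ending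
  outside \<open>M\<close> and from \<open>5 * k * m\<close>.\<close>

lemma lam_sq_x_le_degree_M:
  assumes "u \<in> V"
  shows "lam\<^sup>2 * x u \<le> \<kappa> * card (nbh u) + 17 / 80 * n"
proof -
  have "wt (nbh u) M \<le> 1 * real (arcs_between (nbh u) M)"
    using nbh_subset M_subset x_le_1 by (intro wt_le) auto
  also have "1 * real (arcs_between (nbh u) M) = real (arcs_between (nbh u) M)" by simp
  also have "arcs_between (nbh u) M \<le> arcs_between (nbh u - M) M + arcs_between M M"
    using order_trans[OF arcs_between_mono arcs_between_Un_le, of "nbh u" "nbh u - M" M M M] by auto
  also have "\<dots> \<le> k * (card (nbh u - M) + card M) + 4 * k * card M"
    using nbh_subset M_subset by (intro add_mono bipartite_arcs_le arcs_within_le) auto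
  also have "\<dots> \<le> k * (card (nbh u) + card M) + 4 * k * card M"
    using finite_nbh finite_M by (intro add_mono mult_left_mono card_mono) auto
  finally have "wt (nbh u) M \<le> \<kappa> * card (nbh u) + 5 * (\<kappa> * m)" by (simp add: algebra_simps)
  then show ?thesis using lam_sq_x_le_M[OF assms] \<kappa>_m_le by linarith
qed

section \<open>The k heavy vertices\<close>

definition L :: "'a set" where "L = {z \<in> V. 1 / 2 \<le> x z}"

lemma L_subset_M: "L \<subseteq> M"
proof -
  have "1 / (20 * \<kappa>) \<le> 1 / 2" using \<kappa>_ge_3 by (simp add: field_simps)
  then show ?thesis by (auto simp: L_def M_def)
qed

lemma L_subset: "L \<subseteq> V" by (auto simp: L_def)

lemma finite_L: "finite L" using L_subset finite_V finite_subset by blast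

lemma us_L: "us \<in> L" using us by (simp add: L_def)

text \<open>Walks from \<open>us\<close>, whose weight is 1, force the weighted degree sum over
  \<open>M\<close> up to \<open>k * (n - k) - n / 5\<close>, while the plain degree sum is at most
  \<open>k * n + 4 * k * m\<close>. Vertices of large degree therefore have weight close to 1 in
  total.\<close>

lemma defect_le: "(\<Sum>z\<in>M. card (nbh z) * (1 - x z)) \<le> 211 / 1000 * n"
proof -
  have "lam\<^sup>2 * x us \<le> wt V M + n / 5"
    using lam_sq_x_le_M[OF us(1)] wt_mono[OF nbh_subset order_refl M_subset, of us] by linarith
  then have 1: "\<kappa> * (n - \<kappa>) \<le> (\<Sum>z\<in>M. card (nbh z) * x z) + n / 5"
    using lam_sq_ge us(2) wt_V[OF M_subset] by simp
  have "(\<Sum>z\<in>M. card (nbh z) * (1 - x z)) = (\<Sum>z\<in>M. card (nbh z)) - (\<Sum>z\<in>M. card (nbh z) * x z)"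
    by (simp add: sum_subtractf algebra_simps)
  also have "\<dots> \<le> (4 * \<kappa> * m + \<kappa> * n) - (\<kappa> * (n - \<kappa>) - n / 5)"
    using of_nat_mono[OF degree_sum_le[OF M_subset], where 'a = real] 1
    by (intro diff_mono) (simp_all add: algebra_simps)
  also have "\<dots> = 4 * (\<kappa> * m) + \<kappa>\<^sup>2 + n / 5" by (simp add: algebra_simps power2_eq_square)
  also have "\<dots> \<le> 211 / 1000 * n" using \<kappa>_m_le n_ge \<kappa>_sq_le by linarith
  finally show ?thesis .
qed

lemma degree_L:
  assumes "z \<in> L"
  shows "42 / 100 * n \<le> card (nbh z)"
proof -
  have z: "z \<in> V" "1 / 2 \<le> x z" using assms by (auto simp: L_def)
  have "\<kappa> * (n - \<kappa>) * (1 / 2) \<le> lam\<^sup>2 * x z" using lam_sq_ge z(2) by (intro mult_mono) auto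
  also have "\<dots> \<le> \<kappa> * card (nbh z) + 17 / 80 * n" by (rule lam_sq_x_le_degree_M[OF z(1)])
  also have "17 / 80 * n \<le> \<kappa> * (17 / 240 * n)" using \<kappa>_ge_3 by (simp add: mult_right_mono)
  finally have "\<kappa> * ((n - \<kappa>) / 2) \<le> \<kappa> * (card (nbh z) + 17 / 240 * n)" by (simp add: algebra_simps)
  then have "(n - \<kappa>) / 2 \<le> card (nbh z) + 17 / 240 * n" using \<kappa>_ge_3 by simp
  moreover have "1000 * \<kappa> \<le> n" using n_ge \<kappa>_sq_le by linarith
  ultimately show ?thesis by (simp add: field_simps)
qed

lemma sum_degree_L_ge: "\<kappa> * n - 42 / 100 * n \<le> (\<Sum>z\<in>L. real (card (nbh z)))"
proof -
  have "\<kappa> * (n - \<kappa>) \<le> lam\<^sup>2 * x us" using lam_sq_ge us(2) by simp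
  also have "\<dots> \<le> wt V M + n / 5"
    using lam_sq_x_le_M[OF us(1)] wt_mono[OF nbh_subset order_refl M_subset, of us] by linarith
  also have "wt V M = (\<Sum>z\<in>L. card (nbh z) * x z) + (\<Sum>z\<in>M - L. card (nbh z) * x z)"
    unfolding wt_V[OF M_subset] using L_subset_M finite_M by (simp add: sum.subset_diff)
  also have "(\<Sum>z\<in>L. card (nbh z) * x z) \<le> (\<Sum>z\<in>L. card (nbh z))"
    using L_subset x_le_1 by (simp add: sum_mono mult_left_le subset_iff)
  \<comment> \<open>Below weight 1/2 one has \<open>x z \<le> 1 - x z\<close>, so the defect bounds
    what \<open>M - L\<close> contributes.\<close>
  also have "(\<Sum>z\<in>M - L. card (nbh z) * x z) \<le> (\<Sum>z\<in>M - L. card (nbh z) * (1 - x z))"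
    by (intro sum_mono mult_left_mono) (auto simp: L_def M_def)
  also have "\<dots> \<le> (\<Sum>z\<in>M. card (nbh z) * (1 - x z))"
    using finite_M M_subset x_le_1 by (intro sum_mono2) (auto simp: subset_iff)
  also note defect_le
  finally have "\<kappa> * n - \<kappa>\<^sup>2 - 411 / 1000 * n \<le> (\<Sum>z\<in>L. real (card (nbh z)))"
    by (simp add: algebra_simps power2_eq_square)
  then show ?thesis using n_ge \<kappa>_sq_le by linarith
qed

lemma degree_le: "real (card (nbh z)) \<le> n"
  using card_mono[OF finite_V nbh_subset] by simp

lemma common_nbh_card:
  assumes "finite T"
  shows "n - (\<Sum>l\<in>T. n - card (nbh l)) \<le> card {v \<in> V. T \<subseteq> nbh v}"
proof -
  have "V - {v \<in> V. T \<subseteq> nbh v} \<subseteq> (\<Union>l\<in>T. V - nbh l)" using E_sym by auto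
  then have "card (V - {v \<in> V. T \<subseteq> nbh v}) \<le> card (\<Union>l\<in>T. V - nbh l)"
    using assms finite_V by (intro card_mono) auto
  also have "\<dots> \<le> (\<Sum>l\<in>T. card (V - nbh l))" by (rule card_UN_le[OF assms])
  finally have "real (card (V - {v \<in> V. T \<subseteq> nbh v})) \<le> (\<Sum>l\<in>T. real (card (V - nbh l)))"
    by (simp flip: of_nat_sum)
  moreover have "real (card (V - X)) = n - card X" if "X \<subseteq> V" for X
    using that finite_V by (simp add: card_Diff_subset finite_subset card_mono of_nat_diff)
  ultimately show ?thesis using nbh_subset by simp
qed

text \<open>Fewer than k heavy vertices could not reach the degree sum of
  \<open>sum_degree_L_ge\<close>, since no degree exceeds n. Conversely, \<open>k + 1\<close> of
  them would have a common neighbourhood of linear size, whereas the bipartite bound caps it at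
  \<open>k * (k + 1)\<close>.\<close>

lemma card_L: "card L = k"
proof (rule antisym)
  show "k \<le> card L"
  proof (rule ccontr)
    assume "\<not> k \<le> card L"
    then have "real (card L) \<le> \<kappa> - 1" by linarith
    then have "card L * n \<le> (\<kappa> - 1) * n" by (intro mult_right_mono) auto
    moreover have "(\<Sum>z\<in>L. real (card (nbh z))) \<le> card L * n"
      using degree_le by (intro sum_bounded_above)
    ultimately have "\<kappa> * n - 42 / 100 * n \<le> (\<kappa> - 1) * n" using sum_degree_L_ge by linarith
    moreover have "0 < n" using n_ge \<kappa>_sq_le by linarith
    ultimately show False by (simp add: algebra_simps)
  qed
next
  show "card L \<le> k"
  proof (rule ccontr)
    assume "\<not> card L \<le> k"
    then obtain T where T: "T \<subseteq> L" "card T = Suc k" by (metis not_less_eq_eq obtain_subset_with_card_n)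
    have finT: "finite T" using T finite_L finite_subset by blast
    have n0: "0 < n" using n_ge \<kappa>_sq_le by linarith
    \<comment> \<open>Dividing the total defect by the minimal degree on \<open>L\<close> bounds the
      sum of \<open>1 - x z\<close> by 211/420, just below 51/100.\<close>
    have "42 / 100 * n * (\<Sum>z\<in>T. 1 - x z) \<le> (\<Sum>z\<in>T. card (nbh z) * (1 - x z))"
      unfolding sum_distrib_left using T L_subset x_le_1 degree_L
      by (intro sum_mono mult_right_mono) (auto simp: subset_iff)
    also have "\<dots> \<le> (\<Sum>z\<in>M. card (nbh z) * (1 - x z))"
      using T L_subset_M finite_M M_subset x_le_1 by (intro sum_mono2) (auto simp: subset_iff)
    also note defect_le
    finally have "n * (42 / 100 * (\<Sum>z\<in>T. 1 - x z)) \<le> n * (211 / 1000)" by (simp add: algebra_simps)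
    then have "42 / 100 * (\<Sum>z\<in>T. 1 - x z) \<le> 211 / 1000"
      using n0 by (simp only: mult_le_cancel_left_pos)
    then have d: "(\<Sum>z\<in>T. 1 - x z) \<le> 51 / 100" by linarith
    \<comment> \<open>Division of \<open>lam_sq_x_le_degree_M\<close> by k translates the defect of
      \<open>z\<close> into a bound on its non-neighbours.\<close>
    have "n - card (nbh z) \<le> n * (1 - x z) + \<kappa> + 17 / 80 * n / \<kappa>" if "z \<in> T" for z
    proof -
      have zV: "z \<in> V" using that T L_subset by blast
      have "\<kappa> * (n - \<kappa>) * x z \<le> lam\<^sup>2 * x z"
        using lam_sq_ge x_nonneg[OF zV] by (rule mult_right_mono)
      also have "\<dots> \<le> \<kappa> * card (nbh z) + 17 / 80 * n" by (rule lam_sq_x_le_degree_M[OF zV])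
      also have "\<dots> = \<kappa> * (card (nbh z) + 17 / 80 * n / \<kappa>)" using \<kappa>_ge_3 by (simp add: field_simps)
      finally have "\<kappa> * ((n - \<kappa>) * x z) \<le> \<kappa> * (card (nbh z) + 17 / 80 * n / \<kappa>)" by simp
      then have "(n - \<kappa>) * x z \<le> card (nbh z) + 17 / 80 * n / \<kappa>"
        using \<kappa>_ge_3 by (simp only: mult_le_cancel_left_pos)
      moreover have "\<kappa> * x z \<le> \<kappa> * 1" using x_le_1[OF zV] by (intro mult_left_mono) auto
      ultimately show ?thesis by (simp add: algebra_simps)
    qed
    then have "(\<Sum>z\<in>T. n - card (nbh z)) \<le> (\<Sum>z\<in>T. n * (1 - x z) + \<kappa> + 17 / 80 * n / \<kappa>)"
      by (rule sum_mono)
    also have "\<dots> = n * (\<Sum>z\<in>T. 1 - x z) + (\<kappa> + 1) * (\<kappa> + 17 / 80 * n / \<kappa>)"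
      unfolding sum.distrib sum_distrib_left by (simp add: T(2) algebra_simps)
    also have "\<dots> \<le> n * (51 / 100) + (\<kappa>\<^sup>2 + \<kappa> + 17 / 60 * n)"
    proof (rule add_mono)
      show "n * (\<Sum>z\<in>T. 1 - x z) \<le> n * (51 / 100)" using d by (intro mult_left_mono) auto
      have "(\<kappa> + 1) / \<kappa> \<le> 4 / 3" using \<kappa>_ge_3 by (simp add: field_simps)
      then have "(\<kappa> + 1) / \<kappa> * (17 / 80 * n) \<le> 4 / 3 * (17 / 80 * n)" by (intro mult_right_mono) auto
      then show "(\<kappa> + 1) * (\<kappa> + 17 / 80 * n / \<kappa>) \<le> \<kappa>\<^sup>2 + \<kappa> + 17 / 60 * n"
        by (simp add: algebra_simps power2_eq_square)
    qed
    also have "\<dots> \<le> 85 / 100 * n" using n_ge \<kappa>_sq_le by linarith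
    finally have "15 / 100 * n \<le> card {v \<in> V. T \<subseteq> nbh v}" using common_nbh_card[OF finT] by linarith
    moreover have "real (card {v \<in> V. T \<subseteq> nbh v}) \<le> \<kappa> * (\<kappa> + 1)"
    proof -
      let ?C = "{v \<in> V. T \<subseteq> nbh v}"
      have finC: "finite ?C" using finite_V by simp
      have "?C \<inter> T = {}" using E_irrefl by auto
      then have "arcs_between ?C T \<le> k * (card ?C + card T)"
        using T L_subset by (intro bipartite_arcs_le) auto
      moreover have "arcs_between ?C T = (\<Sum>v\<in>?C. card T)"
        unfolding arcs_between_sum[OF finC] by (intro sum.cong refl arg_cong[of _ _ card]) auto
      ultimately have "card ?C * Suc k \<le> k * (card ?C + Suc k)" by (simp add: T(2))
      then have "card ?C \<le> k * (k + 1)" by (simp add: algebra_simps)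
      then show ?thesis using of_nat_mono[of "card ?C" "k * (k + 1)", where 'a = real]
        by (simp add: algebra_simps)
    qed
    moreover have "\<kappa> * (\<kappa> + 1) = \<kappa>\<^sup>2 + \<kappa>" by (simp add: algebra_simps power2_eq_square)
    ultimately show False using n_ge \<kappa>_sq_le by linarith
  qed
qed

section \<open>The heavy vertices, their common neighbourhood and the rest\<close>

definition C :: "'a set" where "C = {v \<in> V. L \<subseteq> nbh v}"

definition R :: "'a set" where "R = V - L - C"

lemma C_subset: "C \<subseteq> V" and R_subset: "R \<subseteq> V"
  by (auto simp: C_def R_def)

lemma finite_C: "finite C" and finite_R: "finite R"
  using C_subset R_subset finite_V finite_subset by blast+

lemma C_L: "c \<in> C \<Longrightarrow> l \<in> L \<Longrightarrow> (c, l) \<in> E" "c \<in> C \<Longrightarrow> l \<in> L \<Longrightarrow> (l, c) \<in> E"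
  using E_sym by (auto simp: C_def)

lemma partition_LCR: "L \<inter> C = {}" "L \<inter> R = {}" "C \<inter> R = {}" "V = L \<union> C \<union> R"
  using E_irrefl L_subset by (auto simp: C_def R_def)

text \<open>By \<open>sum_degree_L_ge\<close> the k heavy vertices together have at most 42/100 of n
  non-neighbours, counted with multiplicity; all other vertices belong to \<open>C\<close>.\<close>

lemma k_less_card_C: "k < card C"
proof -
  have "(\<Sum>l\<in>L. n - card (nbh l)) = \<kappa> * n - (\<Sum>z\<in>L. real (card (nbh z)))"
    by (simp add: sum_subtractf card_L)
  then have "58 / 100 * n \<le> card C"
    using common_nbh_card[OF finite_L] sum_degree_L_ge unfolding C_def by linarith
  moreover have "1000 * \<kappa> \<le> n" using n_ge \<kappa>_sq_le by linarith
  ultimately have "\<kappa> < card C" using \<kappa>_ge_3 by linarith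
  then show ?thesis by simp
qed

lemma obtain_notin:
  assumes "finite Y" "card Y < card X"
  obtains y where "y \<in> X" "y \<notin> Y"
  using assms by (metis card_mono leD subsetI)

text \<open>The k paths from \<open>c\<close> to \<open>c'\<close> through \<open>L\<close> cannot
  all be blocked: some \<open>l\<close> in \<open>L\<close> avoids \<open>S\<close>, and on
  whichever side it lies it yields a second arc from \<open>A\<close> to \<open>B\<close>.\<close>

lemma C_independent:
  assumes "c \<in> C" "c' \<in> C"
  shows "(c, c') \<notin> E"
proof
  assume "(c, c') \<in> E"
  from separation[OF this] obtain S A B where sep: "S \<union> A \<union> B = V" "card S < k" "c \<in> A" "c' \<in> B"
    "E \<inter> (A \<times> B) \<subseteq> {(c, c')}" by blast
  have "finite S" using sep(1) finite_V by (metis finite_Un)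
  then obtain l where l: "l \<in> L" "l \<notin> S" using sep(2) card_L obtain_notin by metis
  then have "l \<in> A \<or> l \<in> B" using sep(1) L_subset by blast
  moreover have "l \<noteq> c" "l \<noteq> c'" using l assms partition_LCR by auto
  moreover have "(c, l) \<in> E" "(l, c') \<in> E" using C_L assms l by auto
  ultimately show False using sep by blast
qed

text \<open>The same argument with paths through \<open>C\<close>, which is too large to be
  contained in \<open>S\<close>.\<close>

lemma L_independent:
  assumes "l \<in> L" "l' \<in> L"
  shows "(l, l') \<notin> E"
proof
  assume "(l, l') \<in> E"
  from separation[OF this] obtain S A B where sep: "S \<union> A \<union> B = V" "card S < k" "l \<in> A" "l' \<in> B"
    "E \<inter> (A \<times> B) \<subseteq> {(l, l')}" by blast
  have "finite S" using sep(1) finite_V by (metis finite_Un)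
  then obtain c where c: "c \<in> C" "c \<notin> S"
    using sep(2) k_less_card_C obtain_notin by (metis less_trans)
  then have "c \<in> A \<or> c \<in> B" using sep(1) C_subset by blast
  moreover have "c \<noteq> l" "c \<noteq> l'" using c assms partition_LCR by auto
  moreover have "(l, c) \<in> E" "(c, l') \<in> E" using C_L assms c by auto
  ultimately show False using sep by blast
qed

text \<open>If \<open>r\<close> had more than \<open>k\<close> neighbours in \<open>C\<close>, an arc from \<open>r\<close> to one of them could not be
  separated, since the others are joined to it through \<open>L\<close>.\<close>

lemma card_nbh_R_C:
  assumes r: "r \<in> R"
  shows "card (nbh r \<inter> C) \<le> k"
proof (rule ccontr)
  assume neg: "\<not> card (nbh r \<inter> C) \<le> k"
  then have "nbh r \<inter> C \<noteq> {}" by force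
  then obtain c where c: "c \<in> C" "(r, c) \<in> E" by blast
  from separation[OF c(2)] obtain S A B where sep: "S \<union> A \<union> B = V" "A \<inter> B = {}" "card S < k"
    "r \<in> A" "c \<in> B" "E \<inter> (A \<times> B) \<subseteq> {(r, c)}" by blast
  have finS: "finite S" using sep(1) finite_V by (metis finite_Un)
  obtain l where l: "l \<in> L" "l \<notin> S" using finS sep(3) card_L obtain_notin by metis
  have "card (insert c S) \<le> k" using sep(3) card_insert_le_m1[of k S c] by simp
  then obtain c' where c': "c' \<in> nbh r \<inter> C" "c' \<notin> insert c S"
    using neg finS obtain_notin[of "insert c S" "nbh r \<inter> C"] by (metis finite_insert le_less_trans not_less)
  have ne: "r \<noteq> l" "r \<noteq> c'" "l \<noteq> c" using r l c c' partition_LCR by auto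
  have "c' \<in> A" using c' sep C_subset by blast
  moreover have "(c', l) \<in> E" "(l, c) \<in> E" using C_L l c c' by auto
  moreover have "l \<in> A \<or> l \<in> B" using l sep(1) L_subset by blast
  ultimately show False using sep ne by blast
qed

lemma card_nbh_R_L:
  assumes "r \<in> R"
  shows "card (nbh r \<inter> L) \<le> k - 1"
proof -
  have "nbh r \<inter> L \<subset> L" using assms by (auto simp: R_def C_def)
  then have "card (nbh r \<inter> L) < card L" using finite_L by (rule psubset_card_mono[rotated])
  then show ?thesis by (simp add: card_L)
qed

lemma arcs_R_C:
  assumes "Y \<subseteq> R"
  shows "arcs_between Y C \<le> k * card Y"
proof -
  have fin: "finite Y" using assms finite_R finite_subset by blast
  have "(\<Sum>v\<in>Y. card (nbh v \<inter> C)) \<le> of_nat (card Y) * k"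
    using assms card_nbh_R_C by (intro sum_bounded_above) auto
  then show ?thesis by (simp add: arcs_between_sum[OF fin] mult.commute)
qed

lemma arcs_R_L:
  assumes "Y \<subseteq> R"
  shows "arcs_between Y L \<le> (k - 1) * card Y"
proof -
  have fin: "finite Y" using assms finite_R finite_subset by blast
  have "(\<Sum>v\<in>Y. card (nbh v \<inter> L)) \<le> of_nat (card Y) * (k - 1)"
    using assms card_nbh_R_L by (intro sum_bounded_above) auto
  then show ?thesis by (simp add: arcs_between_sum[OF fin] mult.commute)
qed

lemma arcs_R_L_real:
  assumes "Y \<subseteq> R"
  shows "real (arcs_between Y L) \<le> (\<kappa> - 1) * card Y"
  using of_nat_mono[OF arcs_R_L[OF assms], where 'a = real] k_ge_3 by (simp add: of_nat_diff)

lemma arcs_C_C: "Y \<subseteq> C \<Longrightarrow> Y' \<subseteq> C \<Longrightarrow> arcs_between Y Y' = 0"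
  using C_independent by (auto simp: arcs_between_def card_eq_0_iff)

text \<open>\<open>C\<close> is independent, so every arc meets \<open>R\<close>: those between
  \<open>C\<close> and \<open>R\<close> give \<open>k * card R\<close> in each direction, those
  inside \<open>R\<close> at most \<open>4 * k * card R\<close>.\<close>

lemma arcs_CR_CR: "arcs_between (C \<union> R) (C \<union> R) \<le> 6 * k * card R"
proof -
  have "arcs_between (C \<union> R) (C \<union> R)
      = arcs_between C C + arcs_between C R + (arcs_between R C + arcs_between R R)"
    using partition_LCR(3) by (simp add: arcs_between_Un arcs_between_Un_right)
  also have "\<dots> \<le> 6 * k * card R"
    using arcs_R_C[OF order_refl] arcs_C_C[of C C] arcs_within_le[OF R_subset]
    by (simp add: arcs_between_commute[of C R])
  finally show ?thesis .
qed

lemma arcs_to_C: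
  assumes "Y \<subseteq> C \<union> R"
  shows "arcs_between Y C \<le> k * card Y"
proof -
  have Y: "Y = Y \<inter> C \<union> Y \<inter> R" using assms by blast
  have "arcs_between Y C \<le> arcs_between (Y \<inter> C) C + arcs_between (Y \<inter> R) C"
    using arcs_between_Un_le[of "Y \<inter> C" "Y \<inter> R" C] Y by simp
  also have "\<dots> \<le> 0 + k * card (Y \<inter> R)" using arcs_C_C arcs_R_C by (intro add_mono) auto
  also have "\<dots> \<le> k * card Y"
    using assms finite_C finite_R by (auto intro!: mult_left_mono card_mono elim: finite_subset)
  finally show ?thesis .
qed

text \<open>Every vertex of \<open>R\<close> misses a vertex of \<open>L\<close>. The bound on the arcs into \<open>L \<union> X\<close> says that on
  average it replaces it by at most one vertex of \<open>X\<close>, whose weight is at most \<open>\<beta>\<close>.\<close>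

lemma lam_sq_le:
  assumes X: "X \<subseteq> V - L" and \<beta>: "0 \<le> \<beta>" "\<beta> \<le> 1" "\<And>z. z \<in> X \<Longrightarrow> x z \<le> \<beta>"
    and \<eta>: "0 \<le> \<eta>" "\<And>z. z \<in> V - L - X \<Longrightarrow> x z \<le> \<eta>"
    and t: "real (arcs_between (R - X) (L \<union> X)) \<le> \<kappa> * (card (R - X) + t)"
  shows "lam\<^sup>2 \<le> \<kappa> * card C + (\<kappa> - 1) * card R + \<beta> * card R + 6 * \<kappa> * \<eta> * card R
    + \<kappa> * \<beta> * (5 * card X + t)"
proof -
  have CR: "V - L = C \<union> R" "C \<union> R \<subseteq> V" using partition_LCR by blast+
  have finX: "finite X" using X finite_V finite_subset by blast
  define Y where "Y = (C \<union> R) - X"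
  have V: "V = L \<union> (X \<union> Y)" "L \<inter> (X \<union> Y) = {}" "X \<inter> Y = {}"
    using CR X L_subset by (auto simp: Y_def)
  \<comment> \<open>Since \<open>L\<close> is independent, the first step from \<open>us\<close>
    leaves \<open>L\<close>. The ends of the walks are then sorted into \<open>L\<close>,
    \<open>X\<close> and \<open>Y\<close>, of weights at most 1, \<open>\<beta>\<close> and
    \<open>\<eta>\<close>.\<close>
  have "nbh us \<subseteq> C \<union> R" using L_independent us_L nbh_subset CR by blast
  then have "lam\<^sup>2 \<le> wt (C \<union> R) V"
    using lam_sq_x_le[OF us(1)] us(2) wt_mono[of "nbh us" "C \<union> R" V] CR by simp
  also have "\<dots> = wt (C \<union> R) L + wt (C \<union> R) X + wt (C \<union> R) Y"
    using wt_Un_right[OF V(2)] wt_Un_right[OF V(3)] V(1) by simp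
  also have "\<dots> = wt C L + wt R L + wt C X + wt R X + wt (C \<union> R) Y"
    using partition_LCR(3) C_subset R_subset by (simp add: wt_Un)
  finally have 0: "lam\<^sup>2 \<le> wt C L + wt R L + wt C X + wt R X + wt (C \<union> R) Y" .
  have 1: "wt C L \<le> \<kappa> * card C"
  proof -
    have "wt C L \<le> 1 * real (arcs_between C L)"
      using C_subset L_subset x_le_1 by (intro wt_le) auto
    also have "arcs_between C L \<le> card C * card L"
      using finite_C finite_L by (rule arcs_between_le_card)
    finally show ?thesis by (simp add: card_L mult.commute)
  qed
  have 2: "wt (C \<union> R) Y \<le> \<eta> * (6 * \<kappa> * card R)"
  proof -
    have "wt (C \<union> R) Y \<le> \<eta> * real (arcs_between (C \<union> R) Y)"
      using CR \<eta> by (intro wt_le) (auto simp: Y_def)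
    also have "arcs_between (C \<union> R) Y \<le> arcs_between (C \<union> R) (C \<union> R)"
      by (intro arcs_between_mono) (auto simp: Y_def)
    also have "arcs_between (C \<union> R) (C \<union> R) \<le> 6 * k * card R" by (rule arcs_CR_CR)
    finally show ?thesis using \<eta>(1) by (simp add: mult_left_mono)
  qed
  have 3: "wt C X \<le> \<beta> * (\<kappa> * card X)"
  proof -
    have "wt C X \<le> \<beta> * real (arcs_between C X)" using C_subset \<beta> by (intro wt_le) auto
    also have "arcs_between C X \<le> k * card X"
      using arcs_to_C[of X] X CR by (simp add: arcs_between_commute[of C])
    finally show ?thesis using \<beta>(1) by (simp add: mult_left_mono)
  qed
  have RX: "R = (R \<inter> X) \<union> (R - X)" "(R \<inter> X) \<inter> (R - X) = {}" by auto
  have 4: "wt R X \<le> \<beta> * (4 * \<kappa> * card X) + \<beta> * real (arcs_between (R - X) X)"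
  proof -
    have "wt R X = wt (R \<inter> X) X + wt (R - X) X"
      using wt_Un[OF RX(2), of X] RX(1) R_subset by auto
    also have "wt (R \<inter> X) X \<le> wt X X" using X by (intro wt_mono) auto
    also have "wt X X \<le> \<beta> * real (arcs_between X X)" using X \<beta> by (intro wt_le) auto
    also have "arcs_between X X \<le> 4 * k * card X" using X by (intro arcs_within_le) auto
    also have "wt (R - X) X \<le> \<beta> * real (arcs_between (R - X) X)"
      using R_subset \<beta> by (intro wt_le) auto
    finally show ?thesis using \<beta>(1) by (simp add: mult_left_mono)
  qed
  \<comment> \<open>Each arc from \<open>R\<close> to \<open>L\<close> is split into shares
    \<open>1 - \<beta>\<close> and \<open>\<beta>\<close>. The first share uses that a vertex of
    \<open>R\<close> has at most \<open>k - 1\<close> such arcs; on \<open>R - X\<close> the second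
    is pooled with the arcs into \<open>X\<close>, where the hypothesis \<open>t\<close>
    applies.\<close>
  have 5: "wt R L + \<beta> * real (arcs_between (R - X) X)
      \<le> (\<kappa> - 1) * card R + \<beta> * card R + \<beta> * (\<kappa> * t)"
  proof -
    have "wt R L \<le> 1 * real (arcs_between R L)"
      using R_subset L_subset x_le_1 by (intro wt_le) auto
    moreover have "real (arcs_between R L) = arcs_between (R \<inter> X) L + arcs_between (R - X) L"
      using arcs_between_Un[OF RX(2), of L] RX(1) by simp
    moreover have "real (arcs_between (R - X) (L \<union> X)) = arcs_between (R - X) L + arcs_between (R - X) X"
      using X by (subst arcs_between_Un_right) auto
    ultimately have "wt R L + \<beta> * real (arcs_between (R - X) X)
      \<le> (1 - \<beta>) * real (arcs_between R L)
        + \<beta> * (real (arcs_between (R \<inter> X) L) + real (arcs_between (R - X) (L \<union> X)))"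
      by (simp add: algebra_simps)
    also have "\<dots> \<le> (1 - \<beta>) * ((\<kappa> - 1) * card R)
        + \<beta> * ((\<kappa> - 1) * card (R \<inter> X) + \<kappa> * (card (R - X) + t))"
      using \<beta> t by (intro add_mono mult_left_mono arcs_R_L_real) auto
    also have "\<dots> \<le> (1 - \<beta>) * ((\<kappa> - 1) * card R)
        + \<beta> * (\<kappa> * card (R \<inter> X) + \<kappa> * (card (R - X) + t))"
      using \<beta> by (intro add_mono mult_left_mono mult_right_mono) auto
    also have "real (card (R \<inter> X)) = card R - real (card (R - X))"
      using card_Un_disjoint[of "R \<inter> X" "R - X"] RX finite_R by simp
    finally show ?thesis by (simp add: algebra_simps)
  qed
  show ?thesis using 0 1 2 3 4 5 by (simp add: algebra_simps)
qed

section \<open>Smallness of the weights outside L\<close>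

definition \<beta> :: real where "\<beta> = Max (x ` (V - L))"

lemma C_nonempty: "C \<noteq> {}"
  using k_less_card_C by auto

lemma \<beta>: "z \<in> V - L \<Longrightarrow> x z \<le> \<beta>" "\<exists>r\<in>V - L. x r = \<beta>" "0 \<le> \<beta>" "\<beta> < 1 / 2"
proof -
  have fin: "finite (x ` (V - L))" using finite_V by simp
  have ne: "x ` (V - L) \<noteq> {}" using C_nonempty partition_LCR by auto
  show "x z \<le> \<beta>" if "z \<in> V - L" using that fin by (simp add: \<beta>_def)
  show ex: "\<exists>r\<in>V - L. x r = \<beta>" using Max_in[OF fin ne] by (auto simp: \<beta>_def)
  then obtain r where r: "r \<in> V - L" "x r = \<beta>" by blast
  show "0 \<le> \<beta>" using x_nonneg[of r] r by simp
  show "\<beta> < 1 / 2" using r by (auto simp: L_def)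
qed

text \<open>At a vertex outside \<open>L\<close> of maximal weight, the neighbours in
  \<open>L\<close> and in \<open>C\<close> contribute at most k each. Only those in \<open>R\<close>
  are expanded by a second step, so the term free of \<open>card R\<close> is merely linear in
  \<open>lam\<close>.\<close>

lemma lam_sq_\<beta>_le: "lam\<^sup>2 * \<beta> \<le> 2 * \<kappa> * lam + \<kappa> * card R + 5 * \<kappa> * \<beta> * card R"
proof -
  obtain r where r: "r \<in> V - L" "x r = \<beta>" using \<beta>(2) by blast
  have "lam * \<beta> \<le> (\<Sum>w\<in>nbh r. x w)" using lam_x_le[of r] r by simp
  also have "nbh r = (nbh r \<inter> L \<union> nbh r \<inter> C) \<union> nbh r \<inter> R"
    using nbh_subset[of r] partition_LCR(4) by blast
  also have "(\<Sum>w\<in>\<dots>. x w)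
      = (\<Sum>w\<in>nbh r \<inter> L. x w) + (\<Sum>w\<in>nbh r \<inter> C. x w) + (\<Sum>w\<in>nbh r \<inter> R. x w)"
    using partition_LCR finite_nbh by (subst sum.union_disjoint; (subst sum.union_disjoint)?) auto
  also have "(\<Sum>w\<in>nbh r \<inter> L. x w) \<le> \<kappa>"
  proof -
    have "(\<Sum>w\<in>nbh r \<inter> L. x w) \<le> of_nat (card (nbh r \<inter> L)) * 1"
      using x_le_1 L_subset by (intro sum_bounded_above) auto
    also have "card (nbh r \<inter> L) \<le> card L" using finite_L by (intro card_mono) auto
    finally show ?thesis by (simp add: card_L)
  qed
  also have "(\<Sum>w\<in>nbh r \<inter> C. x w) \<le> \<kappa>"
  proof -
    have "(\<Sum>w\<in>nbh r \<inter> C. x w) \<le> of_nat (card (nbh r \<inter> C)) * 1"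
      using x_le_1 C_subset by (intro sum_bounded_above) auto
    also have "card (nbh r \<inter> C) \<le> k"
    proof (cases "r \<in> C")
      case True
      then have "nbh r \<inter> C = {}" using C_independent by auto
      then show ?thesis by simp
    next
      case False
      then show ?thesis using r partition_LCR(4) card_nbh_R_C by blast
    qed
    finally show ?thesis by simp
  qed
  finally have "lam * (lam * \<beta>) \<le> lam * (2 * \<kappa> + (\<Sum>w\<in>nbh r \<inter> R. x w))"
    using lam_pos by (intro mult_left_mono) auto
  then have "lam\<^sup>2 * \<beta> \<le> 2 * \<kappa> * lam + lam * (\<Sum>w\<in>nbh r \<inter> R. x w)"
    by (simp add: algebra_simps power2_eq_square)
  also have "lam * (\<Sum>w\<in>nbh r \<inter> R. x w) \<le> wt (nbh r \<inter> R) V"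
    using R_subset by (intro lam_sum_le) auto
  also have "\<dots> \<le> wt R V" using R_subset by (intro wt_mono) auto
  also have "\<dots> = wt R L + wt R (C \<union> R)"
    using wt_Un_right[of L "C \<union> R" R] partition_LCR by (simp add: Un_assoc Int_Un_distrib)
  also have "wt R L \<le> 1 * real (arcs_between R L)"
    using R_subset L_subset x_le_1 by (intro wt_le) auto
  also have "arcs_between R L \<le> card R * card L"
    using finite_R finite_L by (rule arcs_between_le_card)
  also have "wt R (C \<union> R) \<le> \<beta> * real (arcs_between R (C \<union> R))"
  proof (intro wt_le R_subset \<beta>(1))
    show "z \<in> V - L" if "z \<in> C \<union> R" for z using that partition_LCR by blast
  qed
  also have "arcs_between R (C \<union> R) \<le> 5 * k * card R"
    using arcs_R_C[OF order_refl] arcs_within_le[OF R_subset] partition_LCR(3)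
    by (simp add: arcs_between_Un_right)
  finally show ?thesis using \<beta>(3) by (simp add: card_L mult_left_mono mult_right_mono algebra_simps)
qed

lemma card_C_R: "real (card C) + card R = n - \<kappa>"
proof -
  have "card V = card (L \<union> C) + card R"
    using partition_LCR finite_L finite_C finite_R by (subst card_Un_disjoint[symmetric]) auto
  also have "card (L \<union> C) = card L + card C"
    using partition_LCR finite_L finite_C by (intro card_Un_disjoint)
  finally show ?thesis by (simp add: card_L)
qed

text \<open>\<open>lam_sq_le\<close> is applied with \<open>X = M - L\<close>. Each vertex of
  \<open>R\<close> costs 1 and regains at most \<open>\<beta>\<close>, below 1/2, plus 3/10 from
  arcs to weights below the threshold of \<open>M\<close>. The net loss of 1/5 each has to be
  covered by \<open>6 * k * \<beta> * m\<close>.\<close>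

lemma card_R_le: "card R \<le> 30 * \<kappa> * \<beta> * m"
proof -
  let ?X = "M - L"
  have card_X: "card ?X + k = card M"
    using L_subset_M finite_L finite_M card_L card_mono[OF finite_M L_subset_M]
    by (simp add: card_Diff_subset)
  have "L \<union> ?X = M" using L_subset_M by blast
  moreover have "arcs_between (R - ?X) M \<le> k * (card (R - ?X) + card M)"
    using R_subset M_subset partition_LCR by (intro bipartite_arcs_le) auto
  ultimately have "real (arcs_between (R - ?X) (L \<union> ?X)) \<le> \<kappa> * (card (R - ?X) + card M)"
    by (simp flip: of_nat_add of_nat_mult)
  then have "lam\<^sup>2 \<le> \<kappa> * card C + (\<kappa> - 1) * card R + \<beta> * card R
      + 6 * \<kappa> * (1 / (20 * \<kappa>)) * card R + \<kappa> * \<beta> * (5 * card ?X + card M)"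
    using \<beta>(1,3,4) M_subset by (intro lam_sq_le[of ?X \<beta> "1 / (20 * \<kappa>)" "card M"]) (auto simp: M_def)
  also have "6 * \<kappa> * (1 / (20 * \<kappa>)) = 3 / 10" using \<kappa>_ge_3 by simp
  also have "\<kappa> * \<beta> * (5 * card ?X + card M) \<le> \<kappa> * \<beta> * (6 * m)"
    using card_X \<beta>(3) by (intro mult_left_mono) auto
  also have "\<beta> * card R \<le> 1 / 2 * card R" using \<beta>(4) by (intro mult_right_mono) auto
  finally have "lam\<^sup>2 \<le> \<kappa> * (card C + card R) - 1 / 5 * card R + \<kappa> * \<beta> * (6 * m)"
    by (simp add: algebra_simps)
  then have "1 / 5 * card R \<le> 6 * (\<kappa> * \<beta> * m)"
    using lam_sq_ge card_C_R by (simp add: algebra_simps)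
  then show ?thesis by simp
qed

text \<open>Bootstrapping: \<open>card_R_le\<close> bounds \<open>card R\<close> by a multiple of
  \<open>\<beta>\<close>, so the terms with \<open>card R\<close> in
  \<open>lam_sq_\<beta>_le\<close> are at most half of its left side. Hence
  \<open>lam * \<beta> \<le> 4 * k\<close>, and \<open>lam_ge'\<close> makes \<open>\<beta>\<close>
  at most \<open>1 / (101 * k)\<close>.\<close>

lemma \<kappa>_\<beta>_le: "7 * \<kappa> * \<beta> < 1 / 2"
proof -
  have "card R \<le> 30 * \<kappa> * \<beta> * (405 * \<kappa>\<^sup>2)"
    using card_R_le m_le \<beta>(3) by (meson mult_left_mono mult_nonneg_nonneg of_nat_0_le_iff
        order_trans zero_le_numeral)
  then have R: "card R \<le> 12150 * \<kappa> ^ 3 * \<beta>" by (simp add: power2_eq_square power3_eq_cube algebra_simps)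
  have "5 * \<kappa> * \<beta> * card R \<le> 5 * \<kappa> * (1 / 2) * card R"
    using \<beta>(4) by (intro mult_right_mono mult_left_mono) auto
  then have "\<kappa> * card R + 5 * \<kappa> * \<beta> * card R \<le> 7 / 2 * \<kappa> * card R" by (simp add: algebra_simps)
  also have "\<dots> \<le> 7 / 2 * \<kappa> * (12150 * \<kappa> ^ 3 * \<beta>)" using R by (intro mult_left_mono) auto
  also have "\<dots> = 42525 * (\<kappa>\<^sup>2)\<^sup>2 * \<beta>" by (simp add: power2_eq_square power3_eq_cube)
  finally have 1: "lam\<^sup>2 * \<beta> \<le> 2 * \<kappa> * lam + 42525 * (\<kappa>\<^sup>2)\<^sup>2 * \<beta>" using lam_sq_\<beta>_le by linarith
  have "(404 * \<kappa>\<^sup>2)\<^sup>2 \<le> lam\<^sup>2" using lam_ge' by (intro power_mono) auto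
  moreover have "(404 * \<kappa>\<^sup>2)\<^sup>2 = 163216 * (\<kappa>\<^sup>2)\<^sup>2" by (simp add: power_mult_distrib)
  ultimately have "42525 * (\<kappa>\<^sup>2)\<^sup>2 \<le> 1 / 2 * lam\<^sup>2"
    using zero_le_power2[of "\<kappa>\<^sup>2"] by linarith
  then have "42525 * (\<kappa>\<^sup>2)\<^sup>2 * \<beta> \<le> 1 / 2 * lam\<^sup>2 * \<beta>" using \<beta>(3) by (rule mult_right_mono)
  then have "lam\<^sup>2 * \<beta> \<le> 4 * (\<kappa> * lam)" using 1 by linarith
  then have "lam * (lam * \<beta>) \<le> lam * (4 * \<kappa>)" by (simp add: power2_eq_square algebra_simps)
  then have "lam * \<beta> \<le> 4 * \<kappa>" using lam_pos by simp
  moreover have "404 * \<kappa>\<^sup>2 * \<beta> \<le> lam * \<beta>" using lam_ge' \<beta>(3) by (rule mult_right_mono)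
  ultimately have "\<kappa> * (404 * \<kappa> * \<beta>) \<le> \<kappa> * 4" by (simp add: power2_eq_square)
  then have "404 * \<kappa> * \<beta> \<le> 4" using \<kappa>_ge_3 by simp
  then show ?thesis by simp
qed

text \<open>\<open>lam_sq_le\<close> again, now with \<open>X = {}\<close> and
  \<open>\<eta> = \<beta>\<close>: a vertex of \<open>R\<close> costs 1 and regains at most
  \<open>7 * k * \<beta>\<close>, below 1/2. A nonempty \<open>R\<close> would push
  \<open>lam\<^sup>2\<close> below its lower bound.\<close>

lemma complete_bipartite_structure:
  shows "R = {}" "lam\<^sup>2 = \<kappa> * (n - \<kappa>)"
proof -
  have "real (arcs_between R L) \<le> (\<kappa> - 1) * card R" by (rule arcs_R_L_real) simp
  also have "\<dots> \<le> \<kappa> * card R" by (intro mult_right_mono) auto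
  finally have main: "lam\<^sup>2 \<le> \<kappa> * card C + (\<kappa> - 1) * card R + \<beta> * card R + 6 * \<kappa> * \<beta> * card R"
    using lam_sq_le[of "{}" \<beta> \<beta> 0] \<beta> by simp
  have "\<beta> \<le> \<kappa> * \<beta>" using \<kappa>_ge_3 \<beta>(3) mult_right_mono[of 1 \<kappa> \<beta>] by simp
  then have "\<beta> + 6 * \<kappa> * \<beta> \<le> 1 / 2" using \<kappa>_\<beta>_le by simp
  then have "(\<beta> + 6 * \<kappa> * \<beta>) * card R \<le> 1 / 2 * card R" by (intro mult_right_mono) auto
  then have "lam\<^sup>2 \<le> \<kappa> * (card C + card R) - 1 / 2 * card R" using main by (simp add: algebra_simps)
  then have le: "lam\<^sup>2 \<le> \<kappa> * (n - \<kappa>) - 1 / 2 * card R" using card_C_R by simp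
  then have "card R = 0" using lam_sq_ge by simp
  then show "R = {}" using finite_R by simp
  show "lam\<^sup>2 = \<kappa> * (n - \<kappa>)" using le lam_sq_ge by simp
qed

lemma ex_complete_bipartite:
  "\<exists>X Y. X \<inter> Y = {} \<and> X \<union> Y = V \<and> card X = k \<and> E = X \<times> Y \<union> Y \<times> X"
proof (intro exI conjI)
  show V: "L \<union> C = V" and "L \<inter> C = {}" "card L = k"
    using partition_LCR complete_bipartite_structure(1) card_L by auto
  show "E = L \<times> C \<union> C \<times> L"
  proof (intro equalityI subrelI)
    fix a b assume ab: "(a, b) \<in> E"
    then have "a \<in> L \<union> C" "b \<in> L \<union> C" unfolding V using E_subset by auto
    then show "(a, b) \<in> L \<times> C \<union> C \<times> L"
      using ab L_independent[of a b] C_independent[of a b] by simp blast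
  next
    fix a b assume "(a, b) \<in> L \<times> C \<union> C \<times> L"
    then show "(a, b) \<in> E" using C_L by auto
  qed
qed

end

section \<open>Separations from minimality\<close>

lemma pair_graph_iff:
  "pair_graph G \<longleftrightarrow> finite (pverts G) \<and> parcs G \<subseteq> pverts G \<times> pverts G
    \<and> (\<forall>u v. (u, v) \<in> parcs G \<longrightarrow> (v, u) \<in> parcs G) \<and> (\<forall>v. (v, v) \<notin> parcs G)"
    (is "_ \<longleftrightarrow> ?R")
proof
  assume "pair_graph G"
  then interpret pair_graph G .
  show ?R
    using pair_finite_verts in_arcsD1 in_arcsD2 pair_no_loops arcs_symmetric by fastforce
next
  assume R: ?R
  then have "finite (parcs G)" by (meson finite_SigmaI finite_subset)
  then show "pair_graph G"
    using R by unfold_locales (auto simp: symmetric_def intro!: symI)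
qed

lemma pair_graphD:
  assumes "pair_graph G"
  shows "finite (pverts G)" "parcs G \<subseteq> pverts G \<times> pverts G"
    "(u, v) \<in> parcs G \<Longrightarrow> (v, u) \<in> parcs G" "(v, v) \<notin> parcs G"
  using assms unfolding pair_graph_iff by blast+

lemma pair_graph_del_edges:
  assumes "pair_graph G"
  shows "pair_graph (del_edges G F)"
  using assms unfolding pair_graph_iff del_edges_def by (auto simp: insert_commute)

lemma pair_graph_del_verts:
  assumes "pair_graph G"
  shows "pair_graph (del_verts G S)"
  using assms unfolding pair_graph_iff del_verts_def by auto

lemma pverts_del [simp]:
  "pverts (del_edges G F) = pverts G" "pverts (del_verts G S) = pverts G - S"
  by (simp_all add: del_edges_def del_verts_def)

lemma connected_iff_cut:
  assumes "pair_graph G"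
  shows "connected (with_proj G) \<longleftrightarrow> pverts G \<noteq> {} \<and>
    (\<forall>A \<subseteq> pverts G. A \<noteq> {} \<longrightarrow> A \<noteq> pverts G \<longrightarrow> (\<exists>a\<in>A. \<exists>b\<in>pverts G - A. (a, b) \<in> parcs G))"
proof -
  let ?V = "pverts G" and ?E = "parcs G"
  have symcl: "symcl ?E = ?E"
    using pair_graphD(3)[OF assms] by (auto simp: symcl_def)
  have "(\<forall>u\<in>?V. \<forall>v\<in>?V. (u, v) \<in> rtrancl_on ?V ?E) \<longleftrightarrow>
    (\<forall>A \<subseteq> ?V. A \<noteq> {} \<longrightarrow> A \<noteq> ?V \<longrightarrow> (\<exists>a\<in>A. \<exists>b\<in>?V - A. (a, b) \<in> ?E))" (is "?L \<longleftrightarrow> ?R")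
  proof
    assume L: ?L
    show ?R
    proof (intro allI impI)
      fix A assume A: "A \<subseteq> ?V" "A \<noteq> {}" "A \<noteq> ?V"
      then obtain a b where ab: "a \<in> A" "b \<in> ?V - A" by blast
      show "\<exists>a\<in>A. \<exists>b\<in>?V - A. (a, b) \<in> ?E"
      proof (rule ccontr)
        assume neg: "\<not> ?thesis"
        have "(a, b) \<in> rtrancl_on ?V ?E" using L ab A by blast
        then have "b \<in> A" by (induction rule: rtrancl_on_induct) (use ab neg in blast)+
        then show False using ab by simp
      qed
    qed
  next
    assume R: ?R
    show ?L
    proof (intro ballI)
      fix u v assume uv: "u \<in> ?V" "v \<in> ?V"
      let ?A = "{w \<in> ?V. (u, w) \<in> rtrancl_on ?V ?E}"
      have "?A = ?V"
      proof (rule ccontr)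
        assume "?A \<noteq> ?V"
        moreover have "?A \<noteq> {}" using uv by auto
        ultimately obtain a b where "a \<in> ?A" "b \<in> ?V - ?A" "(a, b) \<in> ?E"
          using R[rule_format, of ?A] by blast
        then show False by (auto intro: rtrancl_on_into_rtrancl_on)
      qed
      then show "(u, v) \<in> rtrancl_on ?V ?E" using uv by blast
    qed
  qed
  then show ?thesis by (simp add: connected_conv symcl)
qed

lemma not_connected_obtain_cut:
  assumes "pair_graph G" "\<not> connected (with_proj G)" "pverts G \<noteq> {}"
  obtains A B where "A \<union> B = pverts G" "A \<inter> B = {}" "A \<noteq> {}" "B \<noteq> {}" "parcs G \<inter> A \<times> B = {}"
proof -
  obtain A where "A \<subseteq> pverts G" "A \<noteq> {}" "A \<noteq> pverts G"
    "\<not> (\<exists>a\<in>A. \<exists>b\<in>pverts G - A. (a, b) \<in> parcs G)"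
    using assms(2,3) unfolding connected_iff_cut[OF assms(1)] by meson
  then show ?thesis by (intro that[of A "pverts G - A"]) blast+
qed

lemma connected_obtain_arc:
  assumes "pair_graph G" "connected (with_proj G)" "A \<union> B = pverts G" "A \<inter> B = {}" "A \<noteq> {}" "B \<noteq> {}"
  obtains a b where "a \<in> A" "b \<in> B" "(a, b) \<in> parcs G"
proof -
  have "A \<subseteq> pverts G" "A \<noteq> pverts G" "pverts G - A = B" using assms(3-6) by blast+
  then show ?thesis using assms(1,2,5) that unfolding connected_iff_cut[OF assms(1)] by metis
qed

lemma k_connected_iff:
  assumes "pair_graph G"
  shows "k_connected k G \<longleftrightarrow>
    (\<forall>S \<subseteq> pverts G. disconnected_or_trivial (del_verts G S) \<longrightarrow> k \<le> card S)"
proof -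
  let ?X = "{card S |S. S \<subseteq> pverts G \<and> disconnected_or_trivial (del_verts G S)}"
  \<comment> \<open>The graph without vertices is not \<open>connected\<close>, so
    \<open>Min\<close> ranges over a nonempty set.\<close>
  have "disconnected_or_trivial (del_verts G (pverts G))"
    using connected_iff_cut[OF pair_graph_del_verts[OF assms, of "pverts G"]]
    by (simp add: disconnected_or_trivial_def)
  then have "?X \<noteq> {}" by blast
  moreover have "?X \<subseteq> card ` Pow (pverts G)" by blast
  then have "finite ?X" using pair_graphD(1)[OF assms] by (meson finite_Pow_iff finite_imageI finite_subset)
  ultimately show ?thesis unfolding k_connected_def vertex_connectivity_def by (auto simp: Min_ge_iff)
qed

lemma finite_edges: "pair_graph G \<Longrightarrow> finite (edges G)"
  unfolding edges_def using pair_graphD(1,2)[of G] finite_subset by (blast intro: finite_SigmaI)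

lemma k_edge_connected_iff:
  assumes "pair_graph G"
  shows "k_edge_connected k G \<longleftrightarrow>
    (\<forall>F \<subseteq> edges G. disconnected_or_trivial (del_edges G F) \<longrightarrow> k \<le> card F)"
proof -
  let ?X = "{card F |F. F \<subseteq> edges G \<and> disconnected_or_trivial (del_edges G F)}"
  have "disconnected_or_trivial (del_edges G (edges G))"
  proof (rule ccontr)
    assume neg: "\<not> ?thesis"
    let ?H = "del_edges G (edges G)"
    have V: "pverts ?H = pverts G" and E: "parcs ?H = {}" by (auto simp: del_edges_def edges_def)
    have con: "connected (with_proj ?H)" "card (pverts G) \<noteq> 1"
      using neg V by (auto simp: disconnected_or_trivial_def)
    then obtain v where v: "v \<in> pverts G"
      using V connected_iff_cut[OF pair_graph_del_edges[OF assms]] by blast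
    have "pverts G \<noteq> {v}" using con(2) by auto
    then show False
      using connected_obtain_arc[OF pair_graph_del_edges[OF assms] con(1), of "{v}" "pverts G - {v}"]
        v V E by auto
  qed
  then have "?X \<noteq> {}" by blast
  moreover have "?X \<subseteq> card ` Pow (edges G)" by blast
  then have "finite ?X" using finite_edges[OF assms] by (meson finite_Pow_iff finite_imageI finite_subset)
  ultimately show ?thesis
    unfolding k_edge_connected_def edge_connectivity_def by (auto simp: Min_ge_iff)
qed

text \<open>A cut found for the edge between \<open>u\<close> and \<open>v\<close> may have
  \<open>u\<close> on either side, whereas \<open>separation\<close> wants it in \<open>A\<close>;
  exchanging the sides repairs this.\<close>

lemma orient_cut:
  assumes "\<And>u v. (u, v) \<in> E \<Longrightarrow> (v, u) \<in> E" "A \<inter> B = {}" "a \<in> A" "b \<in> B" "{a, b} = {u, v}"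
    "\<And>a b. a \<in> A \<Longrightarrow> b \<in> B \<Longrightarrow> (a, b) \<in> E \<Longrightarrow> {a, b} = {u, v}"
  obtains A' B' where "A' \<union> B' = A \<union> B" "A' \<inter> B' = {}" "u \<in> A'" "v \<in> B'" "E \<inter> A' \<times> B' \<subseteq> {(u, v)}"
proof (cases "a = u")
  case True
  then have "b = v" using assms(5) by (auto simp: doubleton_eq_iff)
  then have "E \<inter> A \<times> B \<subseteq> {(u, v)}"
    using assms(2,3,4,6) True by (fastforce simp: doubleton_eq_iff)
  then show ?thesis using assms(2,3,4) True \<open>b = v\<close> by (intro that[of A B]) auto
next
  case False
  then have "a = v" "b = u" using assms(5) by (auto simp: doubleton_eq_iff)
  moreover have "E \<inter> B \<times> A \<subseteq> {(u, v)}"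
    using assms(1,2,6) \<open>a \<in> A\<close> \<open>b \<in> B\<close> \<open>a = v\<close> \<open>b = u\<close>
    by (auto simp: doubleton_eq_iff) blast+
  ultimately show ?thesis using assms by (intro that[of B A]) auto
qed

text \<open>Fewer than k vertices \<open>S\<close> disconnect the graph without the edge from
  \<open>u\<close> to \<open>v\<close>, but not the graph itself. So this edge is the only one
  across the resulting cut.\<close>

lemma minimally_k_connected_separable:
  assumes G: "pair_graph G" and min: "minimally_k_connected k G"
  shows "separable_graph (pverts G) (parcs G) k"
proof
  show "finite (pverts G)" "parcs G \<subseteq> pverts G \<times> pverts G" "(v, v) \<notin> parcs G"
    "(u, v) \<in> parcs G \<Longrightarrow> (v, u) \<in> parcs G" for u v
    using pair_graphD[OF G] by blast+
  fix u v assume uv: "(u, v) \<in> parcs G"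
  define H where "H = del_edges G {{u, v}}"
  have H: "pair_graph H" "pverts H = pverts G" unfolding H_def by (simp_all add: pair_graph_del_edges G)
  have "{u, v} \<in> edges G" using uv by (auto simp: edges_def)
  then have "\<not> k_connected k H" using min by (auto simp: minimally_k_connected_def H_def)
  then obtain S where S: "S \<subseteq> pverts G" "disconnected_or_trivial (del_verts H S)" "card S < k"
    unfolding k_connected_iff[OF H(1)] H(2) by (meson not_le)
  have "\<not> disconnected_or_trivial (del_verts G S)"
    using S(1,3) min unfolding minimally_k_connected_def k_connected_iff[OF G] by (meson not_le)
  then have con: "connected (with_proj (del_verts G S))" "card (pverts G - S) \<noteq> 1"
    by (auto simp: disconnected_or_trivial_def)
  then have discon: "\<not> connected (with_proj (del_verts H S))"
    using S(2) H(2) by (auto simp: disconnected_or_trivial_def)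
  have "pverts (del_verts H S) \<noteq> {}"
    using con(1) H(2) connected_iff_cut[OF pair_graph_del_verts[OF G]] by simp
  from not_connected_obtain_cut[OF pair_graph_del_verts[OF H(1)] discon this]
  obtain A B where AB: "A \<union> B = pverts G - S" "A \<inter> B = {}" "A \<noteq> {}" "B \<noteq> {}"
    "parcs (del_verts H S) \<inter> A \<times> B = {}"
    using H(2) by auto
  have cross: "{a, b} = {u, v}" if "a \<in> A" "b \<in> B" "(a, b) \<in> parcs G" for a b
    using that AB(1,5) by (auto simp: H_def del_verts_def del_edges_def)
  obtain a b where ab: "a \<in> A" "b \<in> B" "(a, b) \<in> parcs (del_verts G S)"
    using connected_obtain_arc[OF pair_graph_del_verts[OF G] con(1)] AB by (metis pverts_del(2))
  then have "{a, b} = {u, v}" using cross by (auto simp: del_verts_def)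
  from orient_cut[OF pair_graphD(3)[OF G] AB(2) ab(1,2) this cross]
  obtain A' B' where AB': "A' \<union> B' = A \<union> B" "A' \<inter> B' = {}" "u \<in> A'" "v \<in> B'"
    "parcs G \<inter> A' \<times> B' \<subseteq> {(u, v)}" by blast
  have "S \<union> A' \<union> B' = pverts G" "A' \<inter> S = {}" "B' \<inter> S = {}" using AB(1) AB'(1) S(1) by blast+
  then show "\<exists>S A B. S \<union> A \<union> B = pverts G \<and> A \<inter> B = {} \<and> A \<inter> S = {} \<and>
      B \<inter> S = {} \<and> card S < k \<and> u \<in> A \<and> v \<in> B \<and> parcs G \<inter> (A \<times> B) \<subseteq> {(u, v)}"
    using AB'(2-5) S(3) by (intro exI[of _ S] exI[of _ A'] exI[of _ B'] conjI)
qed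

text \<open>This converts edge cuts into vertex cuts that spare \<open>u\<close> and
  \<open>v\<close>: from each edge one end outside \<open>{u, v}\<close> is chosen.\<close>

lemma edge_cover_avoiding:
  assumes "finite F" "\<forall>f\<in>F. \<not> f \<subseteq> {u, v}"
  shows "\<exists>S. card S \<le> card F \<and> S \<subseteq> \<Union>F \<and> u \<notin> S \<and> v \<notin> S \<and> (\<forall>f\<in>F. f \<inter> S \<noteq> {})"
proof -
  have "\<forall>f\<in>F. \<exists>w. w \<in> f \<and> w \<noteq> u \<and> w \<noteq> v" using assms(2) by blast
  then obtain g where g: "\<And>f. f \<in> F \<Longrightarrow> g f \<in> f \<and> g f \<noteq> u \<and> g f \<noteq> v" by metis
  show ?thesis using g card_image_le[OF assms(1), of g] by (intro exI[of _ "g ` F"]) blast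
qed

lemma edge_subset_pair:
  assumes "pair_graph G" "f \<in> edges G" "f \<subseteq> {u, v}"
  shows "f = {u, v}"
  using assms pair_graphD(4)[OF assms(1)] by (auto simp: edges_def)

lemma edges_subset: "pair_graph G \<Longrightarrow> f \<in> edges G \<Longrightarrow> f \<subseteq> pverts G"
  using pair_graphD(2) by (fastforce simp: edges_def)

text \<open>As in the vertex version, but a cut \<open>F\<close> of fewer than k further edges has
  to become a vertex set \<open>S\<close>. No edge of \<open>F\<close> joins \<open>u\<close> and
  \<open>v\<close>, so \<open>edge_cover_avoiding\<close> applies, and \<open>u\<close> and
  \<open>v\<close> stay on their sides.\<close>

lemma minimally_k_edge_connected_separable:
  assumes G: "pair_graph G" and min: "minimally_k_edge_connected k G"
  shows "separable_graph (pverts G) (parcs G) k"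
proof
  show "finite (pverts G)" "parcs G \<subseteq> pverts G \<times> pverts G" "(v, v) \<notin> parcs G"
    "(u, v) \<in> parcs G \<Longrightarrow> (v, u) \<in> parcs G" for u v
    using pair_graphD[OF G] by blast+
  fix u v assume uv: "(u, v) \<in> parcs G"
  define H where "H = del_edges G {{u, v}}"
  have H: "pair_graph H" "pverts H = pverts G" unfolding H_def by (simp_all add: pair_graph_del_edges G)
  have "{u, v} \<in> edges G" using uv by (auto simp: edges_def)
  then have "\<not> k_edge_connected k H" using min by (auto simp: minimally_k_edge_connected_def H_def)
  then obtain F where F: "F \<subseteq> edges H" "disconnected_or_trivial (del_edges H F)" "card F < k"
    unfolding k_edge_connected_iff[OF H(1)] by (meson not_le)
  have "edges H \<subseteq> edges G - {{u, v}}" by (auto simp: edges_def H_def del_edges_def)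
  then have FG: "F \<subseteq> edges G" "{u, v} \<notin> F" using F(1) by blast+
  have "\<not> disconnected_or_trivial (del_edges G F)"
    using F(3) FG(1) min unfolding minimally_k_edge_connected_def k_edge_connected_iff[OF G]
    by (meson not_le)
  then have con: "connected (with_proj (del_edges G F))" "card (pverts G) \<noteq> 1"
    by (auto simp: disconnected_or_trivial_def)
  then have discon: "\<not> connected (with_proj (del_edges H F))"
    using F(2) H(2) by (auto simp: disconnected_or_trivial_def)
  have "pverts (del_edges H F) \<noteq> {}" using uv pair_graphD(2)[OF G] H(2) by auto
  from not_connected_obtain_cut[OF pair_graph_del_edges[OF H(1)] discon this]
  obtain A B where AB: "A \<union> B = pverts G" "A \<inter> B = {}" "A \<noteq> {}" "B \<noteq> {}"
    "parcs (del_edges H F) \<inter> A \<times> B = {}"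
    using H(2) by auto
  have "finite F" using FG(1) finite_edges[OF G] finite_subset by blast
  moreover have "\<forall>f\<in>F. \<not> f \<subseteq> {u, v}" using edge_subset_pair[OF G] FG by blast
  ultimately obtain S where S: "card S \<le> card F" "S \<subseteq> \<Union>F" "u \<notin> S" "v \<notin> S"
    "\<forall>f\<in>F. f \<inter> S \<noteq> {}"
    using edge_cover_avoiding by metis
  have SV: "S \<subseteq> pverts G" using S(2) FG(1) edges_subset[OF G] by blast
  have cross: "{a, b} = {u, v} \<or> {a, b} \<in> F" if "a \<in> A" "b \<in> B" "(a, b) \<in> parcs G" for a b
    using that AB(1,5) by (auto simp: H_def del_edges_def)
  have cross': "{a, b} = {u, v}" if "a \<in> A - S" "b \<in> B - S" "(a, b) \<in> parcs G" for a b
  proof -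
    have "{a, b} \<inter> S = {}" using that by simp
    then have "{a, b} \<notin> F" using S(5) by metis
    then show ?thesis using cross[of a b] that by simp
  qed
  obtain a b where ab: "a \<in> A" "b \<in> B" "(a, b) \<in> parcs (del_edges G F)"
    using connected_obtain_arc[OF pair_graph_del_edges[OF G] con(1)] AB by (metis pverts_del(1))
  then have eq: "{a, b} = {u, v}" using cross[of a b] by (auto simp: del_edges_def)
  then have abS: "a \<in> A - S" "b \<in> B - S" using ab S(3,4) by (auto simp: doubleton_eq_iff)
  have disj: "(A - S) \<inter> (B - S) = {}" using AB(2) by blast
  from orient_cut[OF pair_graphD(3)[OF G] disj abS eq cross']
  obtain A' B' where AB': "A' \<union> B' = (A - S) \<union> (B - S)" "A' \<inter> B' = {}" "u \<in> A'" "v \<in> B'"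
    "parcs G \<inter> A' \<times> B' \<subseteq> {(u, v)}"
    by blast
  have "S \<union> A' \<union> B' = pverts G" "A' \<inter> S = {}" "B' \<inter> S = {}" using AB(1) AB'(1) SV by blast+
  then show "\<exists>S A B. S \<union> A \<union> B = pverts G \<and> A \<inter> B = {} \<and> A \<inter> S = {} \<and>
      B \<inter> S = {} \<and> card S < k \<and> u \<in> A \<and> v \<in> B \<and> parcs G \<inter> (A \<times> B) \<subseteq> {(u, v)}"
    using AB'(2-5) le_less_trans[OF S(1) F(3)]
    by (intro exI[of _ S] exI[of _ A'] exI[of _ B'] conjI)
qed

text \<open>Whitney's inequality, for graphs with at least \<open>2 * k\<close> vertices. Fewer than
  k edges cannot join all pairs across the cut, since stars in \<open>F\<close> would then bound
  both sides below k. For a pair not joined by \<open>F\<close>, a vertex cover of \<open>F\<close>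
  avoiding the pair is a small vertex cut.\<close>

lemma k_connected_imp_k_edge_connected:
  assumes G: "pair_graph G" and con: "k_connected k G" and k: "0 < k" "2 * k \<le> card (pverts G)"
  shows "k_edge_connected k G"
  unfolding k_edge_connected_iff[OF G]
proof (intro allI impI, rule ccontr)
  fix F assume F: "F \<subseteq> edges G" "disconnected_or_trivial (del_edges G F)" "\<not> k \<le> card F"
  have finF: "finite F" using F(1) finite_edges[OF G] finite_subset by blast
  have "\<not> connected (with_proj (del_edges G F))" "pverts G \<noteq> {}"
    using F(2) k by (auto simp: disconnected_or_trivial_def)
  then obtain A B where AB: "A \<union> B = pverts G" "A \<inter> B = {}" "A \<noteq> {}" "B \<noteq> {}"
    "parcs (del_edges G F) \<inter> A \<times> B = {}"
    using not_connected_obtain_cut[OF pair_graph_del_edges[OF G]] by (metis pverts_del(1))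
  have finAB: "finite A" "finite B" using AB(1) pair_graphD(1)[OF G] by (metis finite_Un)+
  have "\<exists>u v. u \<in> A \<and> v \<in> B \<and> {u, v} \<notin> F"
  proof (rule ccontr)
    assume that': "\<not> ?thesis"
    then have all: "{u, v} \<in> F" if "u \<in> A" "v \<in> B" for u v using that that' by blast
    obtain a b where ab: "a \<in> A" "b \<in> B" using AB(3,4) by blast
    have "card B \<le> card F"
      using finF ab all by (intro card_inj_on_le[of "\<lambda>v. {a, v}"]) (auto simp: inj_on_def doubleton_eq_iff)
    moreover have "card A \<le> card F"
      using finF ab all by (intro card_inj_on_le[of "\<lambda>u. {u, b}"]) (auto simp: inj_on_def doubleton_eq_iff)
    moreover have "card (pverts G) = card A + card B"
      using AB(1,2) finAB by (metis card_Un_disjoint)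
    ultimately show False using F(3) k by linarith
  qed
  then obtain u v where uv: "u \<in> A" "v \<in> B" "{u, v} \<notin> F" by blast
  have "\<forall>f\<in>F. \<not> f \<subseteq> {u, v}" using edge_subset_pair[OF G] F(1) uv(3) by blast
  then obtain S where S: "card S \<le> card F" "S \<subseteq> \<Union>F" "u \<notin> S" "v \<notin> S"
    "\<forall>f\<in>F. f \<inter> S \<noteq> {}"
    using edge_cover_avoiding[OF finF] by metis
  have "S \<subseteq> pverts G" using S(2) F(1) edges_subset[OF G] by blast
  then have "connected (with_proj (del_verts G S))"
    using con S(1) F(3) unfolding k_connected_iff[OF G] disconnected_or_trivial_def
    by (meson le_trans)
  moreover have "(A - S) \<union> (B - S) = pverts (del_verts G S)" using AB(1) by auto
  moreover have "(A - S) \<inter> (B - S) = {}" "A - S \<noteq> {}" "B - S \<noteq> {}" using AB(2) uv S(3,4) by blast+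
  ultimately obtain a b where ab: "a \<in> A - S" "b \<in> B - S" "(a, b) \<in> parcs (del_verts G S)"
    using connected_obtain_arc[OF pair_graph_del_verts[OF G], of S "A - S" "B - S"] by metis
  then have "{a, b} \<in> F" using AB(5) by (auto simp: del_verts_def del_edges_def)
  moreover have "{a, b} \<inter> S = {}" using ab by simp
  ultimately show False using S(5) by metis
qed

text \<open>Removing the neighbours of \<open>c\<close>, or the edges at \<open>c\<close>, isolates
  \<open>c\<close>, while the size condition leaves another vertex.\<close>

lemma small_degree_not_connected:
  assumes G: "pair_graph G" and c: "c \<in> pverts G" "card (parcs G `` {c}) < k" "k < card (pverts G)"
  shows "\<not> k_connected k G" "\<not> k_edge_connected k G"
proof -
  let ?N = "parcs G `` {c}"
  have N: "?N \<subseteq> pverts G" "c \<notin> ?N" using pair_graphD(2,4)[OF G] by auto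
  have finN: "finite ?N" using N(1) pair_graphD(1)[OF G] finite_subset by blast
  have card: "card (insert c ?N) < card (pverts G)" using c(2,3) N(2) finN by simp
  then obtain w where w: "w \<in> pverts G" "w \<noteq> c" "w \<notin> ?N"
    using finN card_mono[of "insert c ?N" "pverts G"] by fastforce
  have "\<not> connected (with_proj (del_verts G ?N))"
  proof
    assume con: "connected (with_proj (del_verts G ?N))"
    obtain a b where "a \<in> {c}" "b \<in> pverts G - ?N - {c}" "(a, b) \<in> parcs (del_verts G ?N)"
      using connected_obtain_arc[OF pair_graph_del_verts[OF G] con, of "{c}" "pverts G - ?N - {c}"]
        w c(1) N(2) by auto
    then show False by (auto simp: del_verts_def)
  qed
  then have "disconnected_or_trivial (del_verts G ?N)" by (simp add: disconnected_or_trivial_def)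
  then show "\<not> k_connected k G"
    unfolding k_connected_iff[OF G] using N(1) c(2) by (meson not_le)
  let ?F = "(\<lambda>w. {c, w}) ` ?N"
  have "\<not> connected (with_proj (del_edges G ?F))"
  proof
    assume con: "connected (with_proj (del_edges G ?F))"
    obtain a b where "a \<in> {c}" "b \<in> pverts G - {c}" "(a, b) \<in> parcs (del_edges G ?F)"
      using connected_obtain_arc[OF pair_graph_del_edges[OF G] con, of "{c}" "pverts G - {c}"]
        w c(1) N(2) by auto
    then show False by (auto simp: del_edges_def)
  qed
  then have "disconnected_or_trivial (del_edges G ?F)" by (simp add: disconnected_or_trivial_def)
  moreover have "?F \<subseteq> edges G" by (auto simp: edges_def)
  moreover have "card ?F < k" using card_image_le[OF finN] c(2) by (rule le_less_trans)
  ultimately show "\<not> k_edge_connected k G"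
    unfolding k_edge_connected_iff[OF G] by (meson not_le)
qed

section \<open>Complete bipartite graphs: minimality and isomorphism\<close>

lemma pair_graph_complete_bipartite: "pair_graph (complete_bipartite a b)"
  unfolding pair_graph_iff complete_bipartite_def by auto

lemma card_pverts_complete_bipartite: "card (pverts (complete_bipartite a b)) = a + b"
  by (simp add: complete_bipartite_def)

lemma k_connected_complete_bipartite:
  assumes "a \<le> b"
  shows "k_connected a (complete_bipartite a b)"
proof -
  let ?K = "complete_bipartite a b"
  let ?L = "{..<a}" and ?R = "{a..<a + b}"
  note K = pair_graph_complete_bipartite[of a b]
  show ?thesis unfolding k_connected_iff[OF K]
  proof (intro allI impI, rule ccontr)
    fix S assume S: "S \<subseteq> pverts ?K" "disconnected_or_trivial (del_verts ?K S)" "\<not> a \<le> card S"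
    have finS: "finite S" using S(1) pair_graphD(1)[OF K] finite_subset by blast
    have "\<not> ?L \<subseteq> S" using card_mono[OF finS, of ?L] S(3) by auto
    then obtain l where l: "l < a" "l \<notin> S" by auto
    have "\<not> ?R \<subseteq> S" using card_mono[OF finS, of ?R] S(3) assms by auto
    then obtain r where r: "a \<le> r" "r < a + b" "r \<notin> S" by (meson atLeastLessThan_iff subsetI)
    have V: "pverts ?K = ?L \<union> ?R" by (auto simp: complete_bipartite_def)
    have "card (pverts ?K - S) \<noteq> 1"
    proof
      assume "card (pverts ?K - S) = 1"
      then obtain z where "pverts ?K - S = {z}" by (rule card_1_singletonE)
      moreover have "l \<in> pverts ?K - S" "r \<in> pverts ?K - S" using l r V by auto
      ultimately show False using l(1) r(1) by simp
    qed
    then have "\<not> connected (with_proj (del_verts ?K S))"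
      using S(2) by (auto simp: disconnected_or_trivial_def)
    moreover have "pverts (del_verts ?K S) \<noteq> {}" using l V by auto
    ultimately obtain A B where AB: "A \<union> B = pverts ?K - S" "A \<inter> B = {}" "A \<noteq> {}" "B \<noteq> {}"
      "parcs (del_verts ?K S) \<inter> A \<times> B = {}"
      using not_connected_obtain_cut[OF pair_graph_del_verts[OF K]] by (metis pverts_del(2))
    \<comment> \<open>Vertices from opposite parts are adjacent, so the cut never separates them.
      Hence \<open>l\<close> and \<open>r\<close> lie on the same side, and any vertex on the other
      side is adjacent to one of them.\<close>
    have no: False if "x \<in> A" "y \<in> B" "x < a \<longleftrightarrow> \<not> y < a" for x y
    proof -
      have "x \<in> pverts ?K - S" "y \<in> pverts ?K - S" using AB(1) that by blast+
      then have xy: "x < a + b" "y < a + b" "x \<notin> S" "y \<notin> S"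
        by (simp_all add: complete_bipartite_def)
      have "(x, y) \<in> parcs (del_verts ?K S)"
      proof (cases "x < a")
        case True
        then have "a \<le> y" using that(3) by simp
        then show ?thesis using True xy by (simp add: del_verts_def complete_bipartite_def)
      next
        case False
        then have "y < a" using that(3) by simp
        then show ?thesis using False xy by (simp add: del_verts_def complete_bipartite_def)
      qed
      then show False using AB(5) that by blast
    qed
    obtain x y where xy: "x \<in> A" "y \<in> B" using AB(3,4) by blast
    have lr: "l \<in> A \<or> l \<in> B" "r \<in> A \<or> r \<in> B" using AB(1) l r V by auto
    have ra: "\<not> r < a" using r by simp
    consider "l \<in> A" "r \<in> A" | "l \<in> B" "r \<in> B"
      using lr no[of l r] no[of r l] l(1) ra by blast
    then show False
    proof cases
      case 1
      then show False using no[OF 1(1) xy(2)] no[OF 1(2) xy(2)] l(1) ra by blast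
    next
      case 2
      then show False using no[OF xy(1) 2(1)] no[OF xy(1) 2(2)] l(1) ra by blast
    qed
  qed
qed

lemma minimally_connected_complete_bipartite:
  assumes "0 < a" "a \<le> b"
  shows "minimally_k_connected a (complete_bipartite a b)"
    "minimally_k_edge_connected a (complete_bipartite a b)"
proof -
  let ?K = "complete_bipartite a b"
  note K = pair_graph_complete_bipartite[of a b]
  have con: "k_connected a ?K" "k_edge_connected a ?K"
    using k_connected_complete_bipartite[OF assms(2)] assms
    by (auto intro!: k_connected_imp_k_edge_connected K simp: card_pverts_complete_bipartite)
  have del: "\<not> k_connected a (del_edges ?K {e})" "\<not> k_edge_connected a (del_edges ?K {e})"
    if e: "e \<in> edges ?K" for e
  proof -
    let ?H = "del_edges ?K {e}"
    obtain l r where lr: "e = {l, r}" "l < a" "a \<le> r" "r < a + b"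
    proof -
      obtain x y where xy: "e = {x, y}" "(x, y) \<in> parcs ?K" using e by (auto simp: edges_def)
      then show thesis
        by (cases "x < a") (use that[of x y] that[of y x] in \<open>auto simp: complete_bipartite_def\<close>)
    qed
    \<comment> \<open>The end \<open>r\<close> in the part of size \<open>b\<close> is left with at
      most \<open>a - 1\<close> neighbours.\<close>
    have "parcs ?H `` {r} \<subseteq> {..<a} - {l}"
      using lr by (auto simp: del_edges_def complete_bipartite_def)
    from card_mono[OF _ this] have "card (parcs ?H `` {r}) < a" using lr(2) by simp
    moreover have "r \<in> pverts ?H" using lr by (simp add: complete_bipartite_def)
    moreover have "a < card (pverts ?H)" using assms by (simp add: card_pverts_complete_bipartite)
    ultimately show "\<not> k_connected a ?H" "\<not> k_edge_connected a ?H"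
      using small_degree_not_connected[OF pair_graph_del_edges[OF K]] by blast+
  qed
  show "minimally_k_connected a ?K" "minimally_k_edge_connected a ?K"
    using con del by (simp_all add: minimally_k_connected_def minimally_k_edge_connected_def)
qed

lemma digraph_iso_complete_bipartite:
  assumes G: "pair_graph G" and XY: "X \<inter> Y = {}" "X \<union> Y = pverts G" "card X = k"
    and E: "parcs G = X \<times> Y \<union> Y \<times> X"
  shows "digraph_iso (with_proj G) (with_proj (complete_bipartite k (card (pverts G) - k)))"
proof -
  define n where "n = card (pverts G)"
  have fin: "finite X" "finite Y" using XY(2) pair_graphD(1)[OF G] by (metis finite_Un)+
  have cY: "card Y = n - k" and kn: "k \<le> n"
    using card_Un_disjoint[OF fin XY(1)] XY(2,3) by (simp_all add: n_def)
  obtain f where f: "bij_betw f X {0..<k}" using ex_bij_betw_finite_nat[OF fin(1)] XY(3) by auto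
  obtain g where g: "bij_betw g Y {0..<n - k}" using ex_bij_betw_finite_nat[OF fin(2)] cY by auto
  define h where "h v = (if v \<in> X then f v else k + g v)" for v
  have hX: "bij_betw h X {..<k}"
    using f by (subst bij_betw_cong[of X h f]) (auto simp: h_def lessThan_atLeast0)
  have "bij_betw ((+) k) {0..<n - k} {k..<n}"
    using kn by (intro bij_betw_imageI) (auto simp: image_add_atLeastLessThan)
  then have "bij_betw ((+) k \<circ> g) Y {k..<n}" using g by (rule bij_betw_trans[rotated])
  then have hY: "bij_betw h Y {k..<n}"
    using XY(1) by (subst bij_betw_cong[of Y h "(+) k \<circ> g"]) (auto simp: h_def)
  have hV: "bij_betw h (pverts G) ({..<k} \<union> {k..<n})"
    unfolding XY(2)[symmetric] using hX hY by (rule bij_betw_combine) auto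
  define iso where "iso = \<lparr>iso_verts = h, iso_arcs = map_prod h h, iso_head = snd, iso_tail = fst\<rparr>"
  interpret pair_graph G by (rule G)
  have inj: "inj_on h (pverts G)" using hV by (rule bij_betw_imp_inj_on)
  have "inj_on (map_prod h h) (parcs G)"
    using map_prod_inj_on[OF inj inj] pair_graphD(2)[OF G] by (rule inj_on_subset)
  then have "pre_digraph.digraph_isomorphism (with_proj G) iso"
    using inj by (simp add: digraph_isomorphism_def iso_def wf_digraph)
  moreover have "with_proj (complete_bipartite k (n - k)) = app_iso iso (with_proj G)"
  proof -
    have "h ` pverts G = {..<k + (n - k)}" using hV kn by (auto simp: bij_betw_def)
    moreover have "map_prod h h ` (X \<times> Y \<union> Y \<times> X)
        = {..<k} \<times> {k..<k + (n - k)} \<union> {k..<k + (n - k)} \<times> {..<k}"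
      using hX hY kn by (simp add: image_Un bij_betw_def map_prod_surj_on)
    ultimately show ?thesis
      unfolding app_iso_def by (simp add: iso_def with_proj_def complete_bipartite_def E)
  qed
  ultimately show ?thesis unfolding digraph_iso_def n_def by blast
qed

section \<open>The spectral radius\<close>

text \<open>A complex eigenvalue exists, and it is real because symmetry makes the quadratic form
  \<open>q\<close> of its eigenvector equal to its own conjugate.\<close>

lemma symmetric_mat_ex_eigenvalue:
  fixes A :: "real mat"
  assumes A: "A \<in> carrier_mat n n" and n: "0 < n"
    and sym: "\<And>i j. i < n \<Longrightarrow> j < n \<Longrightarrow> A $$ (i, j) = A $$ (j, i)"
  shows "\<exists>x. eigenvalue A x"
proof -
  let ?B = "map_mat complex_of_real A"
  have B: "?B \<in> carrier_mat n n" using A by simp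
  obtain c where c: "eigenvalue ?B c" using spectrum_non_empty[OF B n] by (auto simp: spectrum_def)
  then obtain v where v: "v \<in> carrier_vec n" "v \<noteq> 0\<^sub>v n" "?B *\<^sub>v v = c \<cdot>\<^sub>v v"
    using A by (auto simp: eigenvalue_def eigenvector_def)
  have row: "(\<Sum>j<n. of_real (A $$ (i, j)) * v $ j) = c * v $ i" if "i < n" for i
  proof -
    have "(?B *\<^sub>v v) $ i = (\<Sum>j<n. of_real (A $$ (i, j)) * v $ j)"
      using that A v(1) by (auto simp: scalar_prod_def lessThan_atLeast0 intro!: sum.cong)
    then show ?thesis using v(1,3) that by simp
  qed
  define q where "q = (\<Sum>i<n. \<Sum>j<n. cnj (v $ i) * (of_real (A $$ (i, j)) * v $ j))"
  define N where "N = (\<Sum>i<n. (cmod (v $ i))\<^sup>2)"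
  have "q = (\<Sum>i<n. cnj (v $ i) * (c * v $ i))"
    unfolding q_def sum_distrib_left[symmetric] using row by (intro sum.cong) auto
  also have "\<dots> = c * of_real N"
    unfolding N_def of_real_sum sum_distrib_left
    by (intro sum.cong) (simp_all only: complex_norm_square mult_ac)
  finally have q: "q = c * of_real N" .
  have "cnj q = (\<Sum>i<n. \<Sum>j<n. v $ i * (of_real (A $$ (i, j)) * cnj (v $ j)))"
    by (simp add: q_def)
  also have "\<dots> = (\<Sum>j<n. \<Sum>i<n. v $ i * (of_real (A $$ (i, j)) * cnj (v $ j)))"
    by (rule sum.swap)
  also have "\<dots> = q" unfolding q_def using sym by (intro sum.cong) (auto simp: mult_ac)
  finally have "cnj c * of_real N = c * of_real N" using q by simp
  moreover have "N \<noteq> 0"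
  proof
    assume "N = 0"
    then have "\<forall>i<n. v $ i = 0" unfolding N_def by (simp add: sum_nonneg_eq_0_iff)
    then show False using v(1,2) by (metis carrier_vecD eq_vecI index_zero_vec)
  qed
  ultimately have "c \<in> \<real>" by (simp add: Reals_cnj_iff)
  then obtain r where r: "c = of_real r" by (auto elim: Reals_cases)
  have "of_real (poly (char_poly A) r) = poly (char_poly ?B) c"
    unfolding of_real_hom.char_poly_hom[OF A] r by simp
  also have "\<dots> = 0" using c eigenvalue_root_char_poly[OF B] by simp
  finally show ?thesis using eigenvalue_root_char_poly[OF A] by auto
qed

section \<open>Graph eigenvalues as eigenvalues of vertex weightings\<close>

lemma graph_eigenvalue_enumeration:
  assumes "distinct vs" "set vs = pverts G"
  shows "graph_eigenvalue G x \<longleftrightarrow> eigenvalue (adjacency_mat G vs) x"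
  unfolding graph_eigenvalue_def using assms eigenvalue_adjacency_mat_cong by metis

text \<open>These two facts ensure that the \<open>Max\<close> in
  \<open>graph_spectral_radius\<close> is attained.\<close>

lemma graph_eigenvalue_finite_nonempty:
  assumes G: "pair_graph G" and ne: "pverts G \<noteq> {}"
  shows "finite {x. graph_eigenvalue G x}" "{x. graph_eigenvalue G x} \<noteq> {}"
proof -
  obtain vs where vs: "distinct vs" "set vs = pverts G"
    using finite_distinct_list[OF pair_graphD(1)[OF G]] by blast
  let ?A = "adjacency_mat G vs" and ?n = "length vs"
  have A: "?A \<in> carrier_mat ?n ?n" by (simp add: adjacency_mat_def)
  have eq: "{x. graph_eigenvalue G x} = {x. eigenvalue ?A x}"
    using graph_eigenvalue_enumeration[OF vs] by blast
  have n: "0 < ?n" using vs(2) ne by auto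
  have "char_poly ?A \<noteq> 0" using degree_monic_char_poly[OF A] by force
  then show "finite {x. graph_eigenvalue G x}"
    unfolding eq eigenvalue_root_char_poly[OF A] by (rule poly_roots_finite)
  have "\<exists>x. eigenvalue ?A x"
    using pair_graphD(3)[OF G]
    by (intro symmetric_mat_ex_eigenvalue[OF A n]) (auto simp: adjacency_mat_def)
  then show "{x. graph_eigenvalue G x} \<noteq> {}" unfolding eq by blast
qed

lemma graph_eigenvalue_iff:
  assumes G: "pair_graph G"
  shows "graph_eigenvalue G x \<longleftrightarrow> (\<exists>f. (\<exists>v\<in>pverts G. f v \<noteq> 0) \<and>
    (\<forall>u\<in>pverts G. (\<Sum>v\<in>parcs G `` {u}. f v) = x * f u))"
proof -
  obtain vs where vs: "distinct vs" "set vs = pverts G"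
    using finite_distinct_list[OF pair_graphD(1)[OF G]] by blast
  have sum: "(\<Sum>v\<in>pverts G. (if (u, v) \<in> parcs G then 1 else 0) * f v) = (\<Sum>v\<in>parcs G `` {u}. f v)"
    for u and f :: "'a \<Rightarrow> real"
  proof -
    have "(\<Sum>v\<in>parcs G `` {u}. f v) = (\<Sum>v\<in>pverts G. (if (u, v) \<in> parcs G then 1 else 0) * f v)"
      using pair_graphD(1,2)[OF G] by (intro sum.mono_neutral_cong_left) auto
    then show ?thesis by simp
  qed
  have "graph_eigenvalue G x \<longleftrightarrow> eigenvalue (adjacency_mat G vs) x"
    by (rule graph_eigenvalue_enumeration[OF vs])
  also note eigenvalue_adjacency_mat_iff[OF vs(1), of G x, unfolded vs(2) sum]
  finally show ?thesis .
qed

section \<open>The upper bound and its equality case\<close>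

lemma two_mult_le_card:
  assumes "3 \<le> k" "10368 * real k ^ 3 * (real k + 1)\<^sup>2 \<le> real n"
  shows "2 * k \<le> n"
proof -
  have "1 * 1 \<le> (real k)\<^sup>2 * (real k + 1)\<^sup>2" using assms(1) by (intro mult_mono) auto
  then have "10368 * real k * 1 \<le> 10368 * real k * ((real k)\<^sup>2 * (real k + 1)\<^sup>2)"
    by (intro mult_left_mono) auto
  also have "\<dots> = 10368 * real k ^ 3 * (real k + 1)\<^sup>2"
    by (simp add: power2_eq_square power3_eq_cube)
  finally have "real (2 * k) \<le> real n" using assms(2) by simp
  then show ?thesis by (simp only: of_nat_le_iff)
qed

text \<open>An arbitrary eigenvector enters \<open>dominated_vector\<close> through its absolute
  values, scaled by their maximum.\<close>

lemma large_eigenvalue_complete_bipartite: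
  assumes G: "pair_graph G" and sep: "separable_graph (pverts G) (parcs G) k" and k: "3 \<le> k"
    and n: "10368 * real k ^ 3 * (real k + 1)\<^sup>2 \<le> real (card (pverts G))"
    and ev: "graph_eigenvalue G \<mu>" and \<mu>: "sqrt (real k * (real (card (pverts G)) - real k)) \<le> \<mu>"
  shows "\<mu> = sqrt (real k * (real (card (pverts G)) - real k))
    \<and> (\<exists>X Y. X \<inter> Y = {} \<and> X \<union> Y = pverts G \<and> card X = k \<and> parcs G = X \<times> Y \<union> Y \<times> X)"
proof -
  let ?V = "pverts G" and ?E = "parcs G"
  obtain f where f: "\<exists>v\<in>?V. f v \<noteq> 0" "\<And>u. u \<in> ?V \<Longrightarrow> (\<Sum>v\<in>?E `` {u}. f v) = \<mu> * f u"
    using ev unfolding graph_eigenvalue_iff[OF G] by blast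
  have finV: "finite ?V" by (rule pair_graphD(1)[OF G])
  define mx where "mx = Max ((\<lambda>v. \<bar>f v\<bar>) ` ?V)"
  have le: "\<bar>f v\<bar> \<le> mx" if "v \<in> ?V" for v using that finV by (simp add: mx_def)
  obtain us where us: "us \<in> ?V" "\<bar>f us\<bar> = mx"
    using Max_in[of "(\<lambda>v. \<bar>f v\<bar>) ` ?V"] finV f(1) unfolding mx_def by fastforce
  obtain v where "v \<in> ?V" "f v \<noteq> 0" using f(1) by blast
  then have mx: "0 < mx" using le[of v] by simp
  have "2 * k \<le> card ?V" using two_mult_le_card[OF k n] .
  then have "real k < card ?V" using k by simp
  then have pos: "0 < real k * (card ?V - real k)" using k by simp
  then have \<mu>0: "0 < \<mu>" using \<mu> by (meson less_le_trans real_sqrt_gt_zero)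
  have sq: "real k * (card ?V - real k) \<le> \<mu>\<^sup>2"
    using \<mu> \<mu>0 pos by (metis less_imp_le real_sqrt_le_iff real_sqrt_unique)
  interpret separable_graph ?V ?E k by (rule sep)
  interpret dominated_vector ?V ?E k "\<lambda>v. \<bar>f v\<bar> / mx" \<mu> us
  proof
    fix u assume u: "u \<in> ?V"
    have "\<mu> * \<bar>f u\<bar> = \<bar>\<Sum>v\<in>?E `` {u}. f v\<bar>" using f(2)[OF u] \<mu>0 by (simp add: abs_mult)
    also have "\<dots> \<le> (\<Sum>v\<in>?E `` {u}. \<bar>f v\<bar>)" by (rule sum_abs)
    finally show "\<mu> * (\<bar>f u\<bar> / mx) \<le> (\<Sum>v\<in>?E `` {u}. \<bar>f v\<bar> / mx)"
      using mx by (simp add: sum_divide_distrib[symmetric] divide_right_mono)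
  qed (use k n \<mu>0 sq mx us le in auto)
  have "\<mu> = sqrt (real k * (real (card ?V) - real k))"
    using complete_bipartite_structure(2) \<mu>0 by (metis less_imp_le real_sqrt_unique)
  then show ?thesis using ex_complete_bipartite by blast
qed

text \<open>The eigenvector is constant on each part, with values chosen so that
  \<open>b * sqrt a = sqrt (a * b) * sqrt b\<close>, and likewise with \<open>a\<close> and
  \<open>b\<close> exchanged.\<close>

lemma graph_eigenvalue_complete_bipartite:
  assumes "0 < a" "0 < b"
  shows "graph_eigenvalue (complete_bipartite a b) (sqrt (real a * real b))"
  unfolding graph_eigenvalue_iff[OF pair_graph_complete_bipartite]
proof (intro exI conjI ballI)
  let ?f = "\<lambda>v. if v < a then sqrt (real b) else sqrt (real a)"
  have V: "pverts (complete_bipartite a b) = {..<a + b}" by (simp add: complete_bipartite_def)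
  show "\<exists>v\<in>pverts (complete_bipartite a b). ?f v \<noteq> 0"
    using assms by (intro bexI[of _ 0]) (auto simp: V)
  fix u assume u: "u \<in> pverts (complete_bipartite a b)"
  have sqrt: "real m * sqrt (real m') = sqrt (real m * real m') * sqrt (real m)" for m m' :: nat
    by (simp add: real_sqrt_mult)
  show "(\<Sum>v\<in>parcs (complete_bipartite a b) `` {u}. ?f v) = sqrt (real a * real b) * ?f u"
  proof (cases "u < a")
    case True
    then have "parcs (complete_bipartite a b) `` {u} = {a..<a + b}"
      by (auto simp: complete_bipartite_def)
    then show ?thesis using True sqrt[of b a] by (simp add: mult.commute)
  next
    case False
    then have "parcs (complete_bipartite a b) `` {u} = {..<a}"
      using u by (auto simp: complete_bipartite_def)
    then show ?thesis using False sqrt[of a b] by simp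
  qed
qed

text \<open>The spectral radius is itself an eigenvalue; once it reaches \<open>s\<close>,
  \<open>large_eigenvalue_complete_bipartite\<close> makes it equal to \<open>s\<close> and
  identifies the graph.\<close>

lemma graph_spectral_radius_le:
  assumes G: "pair_graph G" and sep: "separable_graph (pverts G) (parcs G) k" and k: "3 \<le> k"
    and n: "10368 * real k ^ 3 * (real k + 1)\<^sup>2 \<le> real (card (pverts G))"
  defines "s \<equiv> sqrt (real k * (real (card (pverts G)) - real k))"
  shows "graph_spectral_radius G \<le> s"
    and "graph_spectral_radius G = s \<Longrightarrow>
      digraph_iso (with_proj G) (with_proj (complete_bipartite k (card (pverts G) - k)))"
proof -
  have "0 < 10368 * real k ^ 3 * (real k + 1)\<^sup>2" using k by simp
  then have "pverts G \<noteq> {}" using n by auto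
  then have ev: "graph_eigenvalue G (graph_spectral_radius G)"
    using Max_in[OF graph_eigenvalue_finite_nonempty[OF G]] by (simp add: graph_spectral_radius_def)
  note * = large_eigenvalue_complete_bipartite[OF G sep k n ev, folded s_def]
  show "graph_spectral_radius G \<le> s" using * by linarith
  show "digraph_iso (with_proj G) (with_proj (complete_bipartite k (card (pverts G) - k)))"
    if "graph_spectral_radius G = s"
    using * that digraph_iso_complete_bipartite[OF G] by auto
qed

theorem theorem1p3:
  fixes k n :: nat and \<alpha> :: real and K :: "nat pair_pre_digraph"
  assumes "k \<ge> 3"
    and "\<alpha> = 1 / (24 * real k * (real k + 1))"
    and "real n \<ge> 18 * real k / \<alpha>\<^sup>2"
    and "K = complete_bipartite k (n - k)"
  shows "(pair_graph K \<and> card (pverts K) = n \<and> minimally_k_connected k K \<and>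
       (\<forall>G :: 'a pair_pre_digraph.
          pair_graph G \<and> card (pverts G) = n \<and> minimally_k_connected k G \<longrightarrow>
          graph_spectral_radius G \<le> graph_spectral_radius K \<and>
          (graph_spectral_radius G = graph_spectral_radius K \<longrightarrow>
             digraph_iso (with_proj G) (with_proj K))))
    \<and> (pair_graph K \<and> card (pverts K) = n \<and> minimally_k_edge_connected k K \<and>
       (\<forall>G :: 'a pair_pre_digraph.
          pair_graph G \<and> card (pverts G) = n \<and> minimally_k_edge_connected k G \<longrightarrow>
          graph_spectral_radius G \<le> graph_spectral_radius K \<and>
          (graph_spectral_radius G = graph_spectral_radius K \<longrightarrow>
             digraph_iso (with_proj G) (with_proj K))))"
proof -
  have "18 * real k / \<alpha>\<^sup>2 = 18 * real k * (24 * real k * (real k + 1))\<^sup>2"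
    unfolding assms(2) by (simp add: power_divide)
  also have "\<dots> = 10368 * real k ^ 3 * (real k + 1)\<^sup>2"
    by (simp add: power_mult_distrib power2_eq_square power3_eq_cube)
  finally have big: "10368 * real k ^ 3 * (real k + 1)\<^sup>2 \<le> real n" using assms(3) by simp
  have kn: "2 * k \<le> n" by (rule two_mult_le_card[OF assms(1) big])
  have K: "pair_graph K" "card (pverts K) = n"
    using kn by (simp_all add: assms(4) pair_graph_complete_bipartite card_pverts_complete_bipartite)
  have minK: "minimally_k_connected k K" "minimally_k_edge_connected k K"
    using minimally_connected_complete_bipartite[of k "n - k"] assms(1,4) kn by auto
  let ?s = "sqrt (real k * (real n - real k))"
  have "graph_eigenvalue K ?s"
    using graph_eigenvalue_complete_bipartite[of k "n - k"] assms(1,4) kn by (simp add: of_nat_diff)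
  moreover have "pverts K \<noteq> {}" using K(2) kn assms(1) by auto
  ultimately have "?s \<le> graph_spectral_radius K"
    unfolding graph_spectral_radius_def
    using graph_eigenvalue_finite_nonempty(1)[OF K(1)] by (intro Max_ge) auto
  \<comment> \<open>\<open>K\<close> is itself minimally k-connected, so the general bound applies
    to it and its radius is exactly \<open>?s\<close>.\<close>
  moreover have "graph_spectral_radius K \<le> ?s"
    using graph_spectral_radius_le(1)[OF K(1) minimally_k_connected_separable[OF K(1) minK(1)] assms(1)]
      big K(2) by simp
  ultimately have radius: "graph_spectral_radius K = ?s" by simp
  have main: "graph_spectral_radius G \<le> graph_spectral_radius K \<and>
      (graph_spectral_radius G = graph_spectral_radius K \<longrightarrow> digraph_iso (with_proj G) (with_proj K))"
    if "pair_graph G" "card (pverts G) = n" "separable_graph (pverts G) (parcs G) k"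
    for G :: "'a pair_pre_digraph"
    using graph_spectral_radius_le[OF that(1,3) assms(1)] big that(2) assms(4) radius by simp
  show ?thesis
    using K minK main minimally_k_connected_separable minimally_k_edge_connected_separable by blast
qed

end
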